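(* Let $f\in\mathcal{S}_H(\mathcal{S})$ with $b_1=f_{\overline{z}}(0)$, and let $\rho=3-2\sqrt2$. Then for any $z$ with $0<|z|=r<1$ the following bounds hold for the curvature $k_f(z)$ (at the point $f(z)$) of the image of the circle $\{|\zeta|=r\}$ under $f$: $$k_f(z)\le\frac{1+|b_1|}{(1-|b_1|)^2}\left(\frac{1+r}{1-r}\right)^4\frac{r^2+6r+1}{r},$$ $$k_f(z)\ge\frac{1-|b_1|}{(1+|b_1|)^2}\left(\frac{1-r}{1+r}\right)^4\frac{r^2-6r+1}{r}\quad\text{if }0<r\le\rho,$$ $$k_f(z)\ge\frac{1+|b_1|}{(1-|b_1|)^2}\left(\frac{1+r}{1-r}\right)^4\frac{r^2-6r+1}{r}\quad\text{if }\rho<r<1.$$ Moreover, every function $f\in\mathcal{S}_H(\mathcal{S})$ maps the disk $|z|<3-2\sqrt2$ onto a convex domain; that is, the radius of convexity for $\mathcal{S}_H(\mathcal{S})$ is $3-2\sqrt2$.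
   Context: $\mathbb{D}=\{z\in\mathbb{C}:|z|<1\}$. $\mathcal{H}$ is the class of complex-valued harmonic functions $f=h+\overline{g}$ in $\mathbb{D}$ with $h,g$ analytic in $\mathbb{D}$, $h(0)=g(0)=0$, $h'(0)=1$. Such an $f$ is (locally univalent and) sense-preserving if $|h'(z)|^2-|g'(z)|^2>0$ for all $z\in\mathbb{D}$. $\mathcal{S}_H$ is the class of all sense-preserving univalent (injective) $f\in\mathcal{H}$, and $\mathcal{S}^0_H$ is the class of $f\in\mathcal{S}_H$ with $f_{\overline{z}}(0)=0$ (i.e. $g'(0)=0$). $\mathcal{S}$ is the class of analytic univalent functions $\varphi$ on $\mathbb{D}$ with $\varphi(0)=0$, $\varphi'(0)=1$. Define $$\mathcal{S}^0_H(\mathcal{S})=\{h+\overline{g}\in\mathcal{S}^0_H:\ h+e^{i\theta}g\in\mathcal{S}\text{ for some }\theta\in\mathbb{R}\},$$ $$\mathcal{S}_H(\mathcal{S})=\{f=f_0+c\,\overline{f_0}:\ f_0\in\mathcal{S}^0_H(\mathcal{S}),\ c\in\mathbb{D}\}.$$ The curvature is the signed curvature of the curve $\gamma(t)=f(re^{it})$ traversed with increasing $t$: at $z=re^{it}$, $k_f(z)=\operatorname{Im}\big(\overline{\gamma'(t)}\,\gamma''(t)\big)/|\gamma'(t)|^3$. The radius of convexity of a class of functions is the largest $R\in(0,1]$ such that every function in the class maps the disk $|z|<R$ onto a convex domain. *)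

theory Defs
  imports "HOL-Complex_Analysis.Complex_Analysis"
begin

abbreviation unit_disk :: "complex set" (\<open>\<D>\<close>) where
  "\<D> \<equiv> ball 0 1"

text \<open>
  Functions on the unit disk are modelled as total functions \<open>complex \<Rightarrow> complex\<close>; every
  condition below constrains values inside the disk only.
\<close>

text \<open>The Wirtinger derivative \<open>(f\<^sub>x + \<i> f\<^sub>y) / 2\<close> with respect to the conjugate variable.\<close>

definition dzbar :: "(complex \<Rightarrow> complex) \<Rightarrow> complex \<Rightarrow> complex" where
  "dzbar f z = (frechet_derivative f (at z) 1 + \<i> * frechet_derivative f (at z) \<i>) / 2"

text \<open>The normalisation \<open>g 0 = 0\<close> makes \<open>h\<close> and \<open>g\<close> unique on the disk.\<close>

definition canonical_parts ::
  "(complex \<Rightarrow> complex) \<Rightarrow> (complex \<Rightarrow> complex) \<Rightarrow> (complex \<Rightarrow> complex) \<Rightarrow> bool" where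
  "canonical_parts f h g \<longleftrightarrow>
     h holomorphic_on \<D> \<and> g holomorphic_on \<D> \<and>
     h 0 = 0 \<and> g 0 = 0 \<and> deriv h 0 = 1 \<and>
     (\<forall>z\<in>\<D>. f z = h z + cnj (g z))"

definition class_H :: "(complex \<Rightarrow> complex) set" where
  "class_H = {f. \<exists>h g. canonical_parts f h g}"

definition sense_preserving :: "(complex \<Rightarrow> complex) \<Rightarrow> bool" where
  "sense_preserving f \<longleftrightarrow>
     (\<exists>h g. canonical_parts f h g \<and>
        (\<forall>z\<in>\<D>. (cmod (deriv h z))\<^sup>2 - (cmod (deriv g z))\<^sup>2 > 0))"

definition class_SH :: "(complex \<Rightarrow> complex) set" where
  "class_SH = {f \<in> class_H. sense_preserving f \<and> inj_on f \<D>}"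

definition class_SH0 :: "(complex \<Rightarrow> complex) set" where
  "class_SH0 = {f \<in> class_SH. dzbar f 0 = 0}"

definition class_S :: "(complex \<Rightarrow> complex) set" where
  "class_S = {\<phi>. \<phi> holomorphic_on \<D> \<and> inj_on \<phi> \<D> \<and> \<phi> 0 = 0 \<and> deriv \<phi> 0 = 1}"

definition class_SH0_S :: "(complex \<Rightarrow> complex) set" where
  "class_SH0_S = {f \<in> class_SH0. \<exists>h g. canonical_parts f h g \<and>
     (\<exists>\<theta>::real. (\<lambda>z. h z + exp (\<i> * of_real \<theta>) * g z) \<in> class_S)}"

definition class_SH_S :: "(complex \<Rightarrow> complex) set" where
  "class_SH_S = {f. \<exists>f0\<in>class_SH0_S. \<exists>c\<in>\<D>. \<forall>z\<in>\<D>. f z = f0 z + c * cnj (f0 z)}"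

definition signed_curvature :: "(real \<Rightarrow> complex) \<Rightarrow> real \<Rightarrow> real" where
  "signed_curvature \<gamma> t =
     (let \<gamma>' = (\<lambda>s. vector_derivative \<gamma> (at s));
          \<gamma>'' = (\<lambda>s. vector_derivative \<gamma>' (at s))
      in Im (cnj (\<gamma>' t) * \<gamma>'' t) / (cmod (\<gamma>' t)) ^ 3)"

text \<open>
  The argument of \<open>z\<close> is only determined up to multiples of \<open>2 * pi\<close>; as the curve is
  \<open>2 * pi\<close>-periodic, the choice of the principal value is immaterial.
\<close>

definition curvature :: "(complex \<Rightarrow> complex) \<Rightarrow> complex \<Rightarrow> real" where
  "curvature f z = signed_curvature (\<lambda>t. f (of_real (cmod z) * exp (\<i> * of_real t))) (Arg z)"

definition convex_domain :: "complex set \<Rightarrow> bool" where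
  "convex_domain U \<longleftrightarrow> U \<noteq> {} \<and> open U \<and> connected U \<and> convex U"

definition maps_disk_onto_convex :: "(complex \<Rightarrow> complex) set \<Rightarrow> real \<Rightarrow> bool" where
  "maps_disk_onto_convex F R \<longleftrightarrow> (\<forall>f\<in>F. convex_domain (f ` ball 0 R))"

definition is_radius_of_convexity :: "(complex \<Rightarrow> complex) set \<Rightarrow> real \<Rightarrow> bool" where
  "is_radius_of_convexity F R \<longleftrightarrow>
     R \<in> {0<..1} \<and> maps_disk_onto_convex F R \<and>
     (\<forall>R'\<in>{0<..1}. maps_disk_onto_convex F R' \<longrightarrow> R' \<le> R)"

end

theory Submission
  imports Defs
begin

text \<open>
  Write \<open>f\<^sub>0 = h + cnj g\<close> with dilatation \<open>w = g' / h'\<close> and \<open>\<phi> = h + l g\<close> univalent. The affine map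
  \<open>u \<mapsto> u + c cnj u\<close> multiplies the numerator of the curvature by \<open>1 - |c|\<^sup>2\<close> and lengths by factors
  between \<open>1 - |c|\<close> and \<open>1 + |c|\<close>, so everything reduces to \<open>f\<^sub>0\<close>. There the numerator equals
  \<open>|z h'|\<^sup>2 (1 - |w|\<^sup>2) q\<close>, where \<open>q\<close> differs from \<open>Re (1 + z \<phi>'' / \<phi>')\<close> by at most \<open>2 r / (1 - r\<^sup>2)\<close>
  by the Schwarz-Pick lemma. The Koebe bounds for \<open>\<phi>\<close>, which rest on Gronwall's area theorem
  and Bieberbach's bound on the second coefficient, finish the estimate. Positive curvature on
  circles of radius less than \<open>3 - 2 * sqrt 2\<close> makes each line meet the image of such a circle at most
  twice, which forces convexity, and the harmonic Koebe function shows that the radius is optimal.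
\<close>

section \<open>Area in polar coordinates\<close>

text \<open>The constant has two sources. The Koebe bound gives
  \<open>Re (1 + z \<phi>'' / \<phi>')\<close> at least (1 - 4r + r^2) / (1 - r^2), the dilatation
  costs a further 2r / (1 - r^2), and 3 - 2 sqrt 2 is the root in (0,1) of the resulting 1 - 6r +
  r^2. The angle theta enters the error only through a number of modulus 1, so the bound is uniform
  in theta.

  The lower curvature bound has two forms because the curvature is a positive factor times q: once
  the lower bound for q is negative, the factor has to be taken at its largest.

  The area theorem is reached without boundary integrals. The image of an annulus e < |z| < \<rho>
  under 1/z + H is measured from below by change of variables and from above by an enclosing
  ellipse. Both estimates are dominated by \<pi> / e^2, so these terms have to cancel exactly before
  e can tend to 0.

  Convexity rests on the total turning of the tangent being exactly 2 \<pi>. An explicit logarithm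
  of the tangent shows this: its only part that is not periodic in t is
  \<open>\<i> t\<close>.\<close>

no_notation fps_nth (infixl \<open>$\<close> 75)

text \<open>The mean value property: on the circle dz equals \<open>\<i> z dt\<close>, which cancels
  the Cauchy kernel. It makes the cross terms in the area integral vanish.\<close>

lemma has_integral_circle_mean:
  assumes "F holomorphic_on ball 0 1" "0 < r" "r < 1"
  shows "((\<lambda>t. F (of_real r * cis t)) has_integral (2 * of_real pi * F 0)) {0..2*pi}"
proof -
  have "((\<lambda>u. F u/(u-0)) has_contour_integral (2 * of_real pi * \<i> * F 0)) (circlepath 0 r)"
    by (rule Cauchy_integral_circlepath_simple) (use assms in \<open>auto intro!: holomorphic_on_subset[OF assms(1)]\<close>)
  then have "((\<lambda>t. F (of_real r * cis t) / (of_real r * cis t) * of_real r * \<i> * cis t) has_integral (2 * of_real pi * \<i> * F 0)) {0..2*pi}"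
    unfolding circlepath_def by (subst (asm) has_contour_integral_part_circlepath_iff) auto
  also have "(\<lambda>t. F (of_real r * cis t) / (of_real r * cis t) * of_real r * \<i> * cis t) = (\<lambda>t. \<i> * F (of_real r * cis t))"
    using assms by (auto simp: fun_eq_iff field_simps)
  finally have "((\<lambda>t. \<i> * F (of_real r * cis t)) has_integral (2 * of_real pi * \<i> * F 0)) {0..2*pi}" .
  from has_integral_mult_right[OF this, of "-\<i>"] show ?thesis
    by (simp add: algebra_simps)
qed

text \<open>A bridge between two models of the plane: areas of images are computed over
  \<open>real^2\<close>, iterated integrals over pairs. The identification maps boxes to boxes of
  equal content, so integrals transfer along it.\<close>

lemma has_integral_vec2_iterated:
  fixes f :: "real \<Rightarrow> real \<Rightarrow> real"
  assumes cont: "continuous_on ({a..b} \<times> {c..d}) (\<lambda>(x,y). f x y)"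
  shows "((\<lambda>v::real^2. f (v$1) (v$2)) has_integral integral {a..b} (\<lambda>x. integral {c..d} (f x)))
           (cbox (vector [a,c]) (vector [b,d]))"
proof -
  let ?g = "\<lambda>v::real^2. (v$1, v$2)" and ?h = "\<lambda>p. vector [fst p, snd p] :: real^2"
  have gh: "?h (?g v) = v" "?g (?h p) = p" for v p
    by (auto simp: vec_eq_iff forall_2)
  have g_mem: "?g v \<in> cbox (?g a) (?g b) \<longleftrightarrow> v \<in> cbox a b" for v a b
    by (simp add: mem_box_cart forall_2 cbox_Pair_eq conj_ac)
  have gi: "?g ` cbox u v = cbox (?g u) (?g v)" for u v
  proof (intro equalityI subsetI)
    fix p assume "p \<in> cbox (?g u) (?g v)"
    then have "?h p \<in> cbox u v" using g_mem[of "?h p" u v] unfolding gh by simp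
    then show "p \<in> ?g ` cbox u v" by (rule image_eqI[rotated]) (simp only: gh)
  qed (use g_mem in blast)
  have hi: "?h ` cbox u v = cbox (?h u) (?h v)" for u v
  proof -
    have "?h ` cbox u v = ?h ` ?g ` cbox (?h u) (?h v)" unfolding gi gh ..
    then show ?thesis unfolding image_image gh by simp
  qed
  have ct: "measure lborel (?g ` cbox u v) = 1 * measure lborel (cbox u v)" for u v
  proof -
    have "cbox u v = {} \<longleftrightarrow> v$1 < u$1 \<or> v$2 < u$2"
      using forall_2[of "\<lambda>i. \<not> v$i < u$i"] unfolding interval_eq_empty_cart by blast
    then show ?thesis
      unfolding gi by (auto simp: content_Pair content_cbox_if_cart prod_2 UNIV_2)
  qed
  have cont': "continuous_on (cbox (a,c) (b,d)) (\<lambda>(x,y). f x y)"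
    using cont by (simp add: cbox_Pair_eq)
  have "((\<lambda>(x,y). f x y) has_integral integral (cbox (a,c) (b,d)) (\<lambda>(x,y). f x y)) (cbox (a,c) (b,d))"
    using integrable_continuous[OF cont'] by (rule integrable_integral)
  also have "integral (cbox (a,c) (b,d)) (\<lambda>(x,y). f x y) = integral {a..b} (\<lambda>x. integral {c..d} (f x))"
    using integral_prod_continuous[OF cont'] by simp
  finally have I: "((\<lambda>(x,y). f x y) has_integral integral {a..b} (\<lambda>x. integral {c..d} (f x))) (cbox (a,c) (b,d))" .
  have "((\<lambda>v. (\<lambda>(x,y). f x y) (?g v)) has_integral (1/1) *\<^sub>R integral {a..b} (\<lambda>x. integral {c..d} (f x))) (?h ` cbox (a,c) (b,d))"
  proof (rule has_integral_twiddle[OF _ _ _ _ _ _ ct I])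
    show "?h (?g x) = x" for x by (rule gh)
    show "?g (?h x) = x" for x by (rule gh)
    show "continuous (at x) ?g" for x by (intro continuous_intros)
    show "\<exists>w z. ?g ` cbox u v = cbox w z" for u v using gi by blast
    show "\<exists>w z. ?h ` cbox u v = cbox w z" for u v using hi by blast
  qed simp
  then show ?thesis unfolding hi by simp
qed

section \<open>Plane areas as Lebesgue measure in \<open>real^2\<close>\<close>

definition c2v :: "complex \<Rightarrow> real^2" where "c2v z = vector [Re z, Im z]"

lemma c2v_nth [simp]: "c2v z $ 1 = Re z" "c2v z $ 2 = Im z"
  by (simp_all add: c2v_def)

lemma inj_c2v: "inj c2v"
  by (auto simp: inj_on_def vec_eq_iff forall_2 complex_eq_iff)

lemma bounded_linear_c2v: "bounded_linear c2v"
proof -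
  have "linear c2v"
    by (rule linearI) (auto simp: vec_eq_iff forall_2)
  then show ?thesis by (rule linear_conv_bounded_linear[THEN iffD1])
qed

lemma c2v_cball: "c2v ` cball 0 r = cball 0 r"
proof
  have n: "norm (c2v z) = cmod z" for z
    by (simp add: norm_vec_def L2_set_def UNIV_2 cmod_def)
  show "c2v ` cball 0 r \<subseteq> cball 0 r" by (auto simp: n)
  show "cball 0 r \<subseteq> c2v ` cball 0 r"
  proof
    fix v :: "real^2" assume "v \<in> cball 0 r"
    moreover have "v = c2v (Complex (v$1) (v$2))" by (simp add: vec_eq_iff forall_2)
    ultimately show "v \<in> c2v ` cball 0 r" using n[of "Complex (v$1) (v$2)"]
      by (metis (no_types, lifting) image_eqI mem_cball_0)
  qed
qed

text \<open>The real-linear map \<open>w + \<beta> * cnj w\<close> has determinant 1 - |\<beta>|^2,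
  which lies between 0 and 1, so the ellipse has no more area than the disk it comes from.\<close>

lemma measure_ellipse:
  assumes "r \<ge> 0" "cmod \<beta> \<le> 1"
  shows "c2v ` ((\<lambda>w. a + (w + \<beta> * cnj w)) ` cball 0 r) \<in> lmeasurable"
    and "measure lebesgue (c2v ` ((\<lambda>w. a + (w + \<beta> * cnj w)) ` cball 0 r)) \<le> pi * r\<^sup>2"
proof -
  define L :: "real^2 \<Rightarrow> real^2" where
    "L = (\<lambda>v. vector [v$1 + Re \<beta> * v$1 + Im \<beta> * v$2, v$2 + Im \<beta> * v$1 - Re \<beta> * v$2])"
  have lin: "linear L"
    unfolding L_def by (rule linearI) (auto simp: vec_eq_iff forall_2 algebra_simps)
  have "c2v (a + (w + \<beta> * cnj w)) = c2v a + L (c2v w)" for w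
    unfolding L_def by (simp add: vec_eq_iff forall_2 algebra_simps)
  then have eq: "c2v ` ((\<lambda>w. a + (w + \<beta> * cnj w)) ` cball 0 r) = (\<lambda>v. c2v a + v) ` (L ` cball 0 r)"
    unfolding c2v_cball[symmetric] by (simp add: image_image)
  have m: "L ` cball 0 r \<in> lmeasurable"
    by (intro measurable_linear_image lin lmeasurable_cball)
  then show "c2v ` ((\<lambda>w. a + (w + \<beta> * cnj w)) ` cball 0 r) \<in> lmeasurable"
    unfolding eq by (rule measurable_translation)
  have det: "det (matrix L) = 1 - (cmod \<beta>)\<^sup>2"
    unfolding det_2 matrix_def L_def cmod_power2 by (simp add: axis_def power2_eq_square algebra_simps)
  have "measure lebesgue (c2v ` ((\<lambda>w. a + (w + \<beta> * cnj w)) ` cball 0 r)) = \<bar>1 - (cmod \<beta>)\<^sup>2\<bar> * measure lebesgue (cball 0 r :: (real^2) set)"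
    unfolding eq using measure_translation[of "c2v a" "L ` cball 0 r"] measure_linear_image[OF lin lmeasurable_cball, of 0 r] det by simp
  also have "measure lebesgue (cball 0 r :: (real^2) set) = pi * r\<^sup>2"
    using content_cball[OF assms(1), of "0::real^2"] by (simp add: unit_ball_vol_2)
  also have "\<bar>1 - (cmod \<beta>)\<^sup>2\<bar> * (pi * r\<^sup>2) \<le> 1 * (pi * r\<^sup>2)"
    using assms by (intro mult_right_mono) (auto simp: abs_le_iff power_le_one)
  finally show "measure lebesgue (c2v ` ((\<lambda>w. a + (w + \<beta> * cnj w)) ` cball 0 r)) \<le> pi * r\<^sup>2" by simp
qed

text \<open>The area is the integral of the squared modulus of the derivative. Powers of z are
  orthogonal on circles, so every Taylor coefficient of \<open>H\<close> contributes a nonnegative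
  amount, and the bound keeps only \<open>1/z\<close> and the linear term.\<close>

lemma area_of_annulus_image_ge:
  assumes H: "H holomorphic_on ball 0 1" and inj: "inj_on (\<lambda>z. 1/z + H z) (ball 0 1 - {0})"
    and e: "0 < e" "e < \<rho>" "\<rho> < 1"
    and K: "K \<in> lmeasurable" "\<And>z. e \<le> cmod z \<Longrightarrow> cmod z < 1 \<Longrightarrow> c2v (1/z + H z) \<in> K"
  shows "pi * (1/e\<^sup>2 - 1/\<rho>\<^sup>2 + (cmod (deriv H 0))\<^sup>2 * (\<rho>\<^sup>2 - e\<^sup>2)) \<le> measure lebesgue K"
proof -
  define b where "b = deriv H 0"
  define G' where "G' = (\<lambda>z. - 1/z\<^sup>2 + deriv H z)"
  \<comment> \<open>The box is open so that polar coordinates are injective on it; its boundary does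
    not affect the integral.\<close>
  define S :: "(real^2) set" where "S = box (vector [e,0]) (vector [\<rho>,2*pi])"
  define z where "z = (\<lambda>v::real^2. of_real (v$1) * cis (v$2))"
  define \<Phi> where "\<Phi> = (\<lambda>v. c2v (1/z v + H (z v)))"
  define \<Phi>' where "\<Phi>' = (\<lambda>v w::real^2. c2v (G' (z v) * (of_real (w$1) * cis (v$2) + \<i> * cis (v$2) * of_real (v$1) * of_real (w$2))))"
  define J where "J = (\<lambda>v::real^2. v$1 * (cmod (G' (z v)))\<^sup>2)"
  \<comment> \<open>\<open>2 * Re (E x z)\<close> collects the cross terms of the squared derivative
    on the circle of radius \<open>x\<close>. There \<open>cnj (1/z\<^sup>2)\<close> equals
    \<open>z\<^sup>2 / x^4\<close>, which makes the expression holomorphic in \<open>z\<close>; it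
    vanishes at 0, and so does its mean.\<close>
  define E where "E = (\<lambda>x z::complex. - b * z\<^sup>2 / of_real x^4 + (cnj b - z\<^sup>2 / of_real x^4) * (deriv H z - b))"
  define f where "f = (\<lambda>x y::real. x * (1/x^4 + (cmod b)\<^sup>2) + 2 * x * Re (E x (of_real x * cis y)))"
  have H': "deriv H holomorphic_on ball 0 1" using H by (intro holomorphic_deriv) auto
  have memS: "v \<in> S \<longleftrightarrow> e < v$1 \<and> v$1 < \<rho> \<and> 0 < v$2 \<and> v$2 < 2*pi" for v
    by (auto simp: S_def mem_box_cart forall_2)
  have memC: "v \<in> cbox (vector [e,0]) (vector [\<rho>,2*pi]) \<longleftrightarrow> e \<le> v$1 \<and> v$1 \<le> \<rho> \<and> 0 \<le> v$2 \<and> v$2 \<le> 2*pi" for v :: "real^2"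
    by (auto simp: mem_box_cart forall_2)
  have cz: "cmod (z v) = \<bar>v$1\<bar>" for v by (simp add: z_def norm_mult)
  have der: "(\<Phi> has_derivative \<Phi>' v) (at v within S)" if v: "v \<in> S" for v
  proof -
    have z0: "z v \<noteq> 0" "z v \<in> ball 0 1" using v e cz[of v] by (auto simp: memS)
    have "(H has_field_derivative deriv H (z v)) (at (z v))"
      using holomorphic_derivI[OF H open_ball z0(2)] .
    then have "((\<lambda>z. 1/z + H z) has_field_derivative G' (z v)) (at (z v))"
      unfolding G'_def using z0 by (auto intro!: derivative_eq_intros simp: power2_eq_square)
    then have 1: "((\<lambda>z. 1/z + H z) has_derivative (\<lambda>w. G' (z v) * w)) (at (z v))"
      by (simp add: has_field_derivative_def)
    have c: "(cis has_derivative (\<lambda>t. t *\<^sub>R (\<i> * cis u))) (at u)" for u :: real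
    proof -
      have "((\<lambda>t. exp (\<i> * of_real t)) has_vector_derivative (\<i> * exp (\<i> * of_real u))) (at u)"
        by (auto intro!: derivative_eq_intros has_vector_derivative_real_field)
      then show ?thesis unfolding cis_conv_exp has_vector_derivative_def by simp
    qed
    have n: "((\<lambda>v::real^2. v$i) has_derivative (\<lambda>w. w$i)) (at v)" for i
      by (rule bounded_linear.has_derivative[OF bounded_linear_vec_nth]) simp
    have "((\<lambda>v. cis (v$2)) has_derivative (\<lambda>w. (w$2) *\<^sub>R (\<i> * cis (v$2)))) (at v)"
      using has_derivative_compose[OF n c] by simp
    moreover have "((\<lambda>v::real^2. complex_of_real (v$1)) has_derivative (\<lambda>w. of_real (w$1))) (at v)"
      by (rule has_derivative_of_real[OF n])
    ultimately have 2: "(z has_derivative (\<lambda>w. of_real (v$1) * ((w$2) *\<^sub>R (\<i> * cis (v$2))) + of_real (w$1) * cis (v$2))) (at v)"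
      unfolding z_def by (intro has_derivative_mult)
    have "((\<lambda>v. 1/z v + H (z v)) has_derivative (\<lambda>w. G' (z v) * (of_real (v$1) * ((w$2) *\<^sub>R (\<i> * cis (v$2))) + of_real (w$1) * cis (v$2)))) (at v)"
      using has_derivative_compose[OF 2 1] by simp
    from bounded_linear.has_derivative[OF bounded_linear_c2v this]
    have "(\<Phi> has_derivative \<Phi>' v) (at v)"
      unfolding \<Phi>_def \<Phi>'_def by (simp add: scaleR_conv_of_real algebra_simps)
    then show ?thesis by (rule has_derivative_at_withinI)
  qed
  have det: "\<bar>det (matrix (\<Phi>' v))\<bar> = J v" if "v \<in> S" for v
  proof -
    define A where "A = G' (z v) * cis (v$2)"
    have "\<Phi>' v (axis 1 1) = c2v A" "\<Phi>' v (axis 2 1) = c2v (A * \<i> * of_real (v$1))"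
      by (simp_all add: \<Phi>'_def A_def axis_def algebra_simps)
    then have "det (matrix (\<Phi>' v)) = v$1 * ((Re A)\<^sup>2 + (Im A)\<^sup>2)"
      unfolding det_2 matrix_def by (simp add: power2_eq_square algebra_simps)
    also have "(Re A)\<^sup>2 + (Im A)\<^sup>2 = (cmod (G' (z v)))\<^sup>2"
      unfolding cmod_power2[symmetric] A_def by (simp add: norm_mult)
    finally show ?thesis using that e by (simp add: memS J_def)
  qed
  have inj\<Phi>: "inj_on \<Phi> S"
  proof (rule inj_onI)
    fix v w assume vw: "v \<in> S" "w \<in> S" "\<Phi> v = \<Phi> w"
    have "1/z v + H (z v) = 1/z w + H (z w)" using vw inj_c2v unfolding \<Phi>_def by (auto dest: injD)
    moreover have "z v \<in> ball 0 1 - {0}" "z w \<in> ball 0 1 - {0}"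
      using vw e cz[of v] cz[of w] by (auto simp: memS)
    ultimately have zz: "z v = z w" using inj by (auto dest: inj_onD)
    then have 1: "v$1 = w$1" using cz[of v] cz[of w] vw e by (auto simp: memS)
    then have "cis (v$2) = cis (w$2)" using zz vw e by (auto simp: z_def memS)
    then have "v$2 = w$2"
      using exp_complex_eqI[of "\<i> * of_real (v$2)" "\<i> * of_real (w$2)"] vw
      by (auto simp: memS cis_conv_exp)
    with 1 show "v = w" by (simp add: vec_eq_iff forall_2)
  qed
  have SL: "S \<in> sets lebesgue" by (simp add: S_def)
  have contz: "continuous_on A z" for A unfolding z_def cis_conv_exp by (intro continuous_intros)
  have contJ: "continuous_on (cbox (vector [e,0]) (vector [\<rho>,2*pi])) J"
  proof -
    have "continuous_on (cbox (vector [e,0]) (vector [\<rho>,2*pi])) (\<lambda>v. deriv H (z v))"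
      by (rule continuous_on_compose2[OF holomorphic_on_imp_continuous_on[OF H'] contz])
        (use e cz memC in auto)
    moreover have "z v \<noteq> 0" if "v \<in> cbox (vector [e,0]) (vector [\<rho>,2*pi])" for v
      using cz[of v] that e memC by auto
    ultimately show ?thesis
      unfolding J_def G'_def by (intro continuous_intros contz) auto
  qed
  have intJ: "J integrable_on S"
    unfolding S_def integrable_on_open_interval by (rule integrable_continuous[OF contJ])
  have intD: "(\<lambda>x. \<bar>det (matrix (\<Phi>' x))\<bar>) integrable_on S"
    using integrable_eq[OF intJ] det by metis
  have mm: "\<Phi> ` S \<in> lmeasurable"
    using measurable_differentiable_image_eq[OF SL der inj\<Phi>] intD by blast
  have "measure lebesgue (\<Phi> ` S) = integral S (\<lambda>x. \<bar>det (matrix (\<Phi>' x))\<bar>)"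
    by (rule measure_differentiable_image_eq[OF SL der inj\<Phi> intD])
  also have "\<dots> = integral S J" by (rule integral_cong) (use det in auto)
  also have "\<dots> = integral (cbox (vector [e,0]) (vector [\<rho>,2*pi])) J"
    unfolding S_def by (rule integral_open_interval)
  finally have area: "measure lebesgue (\<Phi> ` S) = integral (cbox (vector [e,0]) (vector [\<rho>,2*pi])) J" .
  have "\<Phi> ` S \<subseteq> K"
    using K(2) cz e by (auto simp: \<Phi>_def memS)
  then have le: "measure lebesgue (\<Phi> ` S) \<le> measure lebesgue K"
    using mm K(1) by (intro measure_mono_fmeasurable) (auto simp: fmeasurableD)
  have contf: "continuous_on ({e..\<rho>} \<times> {0..2*pi}) (\<lambda>(x,y). f x y)"
  proof -
    have "continuous_on ({e..\<rho>} \<times> {0..2*pi}) (\<lambda>p. deriv H (of_real (fst p) * cis (snd p)))"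
      by (rule continuous_on_compose2[OF holomorphic_on_imp_continuous_on[OF H']])
        (use e in \<open>auto simp: cis_conv_exp norm_mult intro!: continuous_intros\<close>)
    then show ?thesis
      unfolding f_def E_def case_prod_unfold cis_conv_exp using e by (intro continuous_intros) auto
  qed
  have inner: "integral {0..2*pi} (f x) = 2 * pi * (x * (1/x^4 + (cmod b)\<^sup>2))" if x: "x \<in> {e..\<rho>}" for x
  proof -
    have "E x holomorphic_on ball 0 1" unfolding E_def using x e by (intro holomorphic_intros H') auto
    then have "((\<lambda>t. E x (of_real x * cis t)) has_integral (2 * of_real pi * E x 0)) {0..2*pi}"
      using x e by (intro has_integral_circle_mean) auto
    moreover have "E x 0 = 0" by (simp add: E_def b_def)
    ultimately have "((\<lambda>t. E x (of_real x * cis t)) has_integral 0) {0..2*pi}" by simp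
    from has_integral_linear[OF this bounded_linear_Re]
    have "((\<lambda>t. Re (E x (of_real x * cis t))) has_integral 0) {0..2*pi}" by (simp add: o_def)
    from has_integral_add[OF has_integral_const_real[of "x * (1/x^4 + (cmod b)\<^sup>2)" 0 "2*pi"] has_integral_mult_right[OF this, of "2*x"]]
    have "(f x has_integral 2 * pi * (x * (1/x^4 + (cmod b)\<^sup>2))) {0..2*pi}"
      by (simp add: f_def[abs_def])
    then show ?thesis by (rule integral_unique)
  qed
  have outer: "((\<lambda>x. 2 * pi * (x * (1/x^4 + (cmod b)\<^sup>2))) has_integral
       pi * ((cmod b)\<^sup>2 * \<rho>\<^sup>2 - 1/\<rho>\<^sup>2) - pi * ((cmod b)\<^sup>2 * e\<^sup>2 - 1/e\<^sup>2)) {e..\<rho>}"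
  proof (rule fundamental_theorem_of_calculus)
    fix x assume "x \<in> {e..\<rho>}"
    then have "x > 0" using e by auto
    then show "((\<lambda>x. pi * ((cmod b)\<^sup>2 * x\<^sup>2 - 1/x\<^sup>2)) has_vector_derivative 2 * pi * (x * (1/x^4 + (cmod b)\<^sup>2))) (at x within {e..\<rho>})"
      unfolding has_real_derivative_iff_has_vector_derivative[symmetric]
      by (auto intro!: derivative_eq_intros simp: field_simps power2_eq_square eval_nat_numeral)
  qed (use e in auto)
  have "integral {e..\<rho>} (\<lambda>x. integral {0..2*pi} (f x)) = integral {e..\<rho>} (\<lambda>x. 2 * pi * (x * (1/x^4 + (cmod b)\<^sup>2)))"
    by (rule integral_cong) (use inner in auto)
  also have "\<dots> = pi * (1/e\<^sup>2 - 1/\<rho>\<^sup>2 + (cmod b)\<^sup>2 * (\<rho>\<^sup>2 - e\<^sup>2))"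
    using integral_unique[OF outer] by (simp add: algebra_simps)
  finally have fI: "((\<lambda>v::real^2. f (v$1) (v$2)) has_integral pi * (1/e\<^sup>2 - 1/\<rho>\<^sup>2 + (cmod b)\<^sup>2 * (\<rho>\<^sup>2 - e\<^sup>2)))
      (cbox (vector [e,0]) (vector [\<rho>,2*pi]))"
    using has_integral_vec2_iterated[OF contf] by simp
  have fJ: "f (v$1) (v$2) \<le> J v" if v: "v \<in> cbox (vector [e,0]) (vector [\<rho>,2*pi])" for v
  proof -
    define x where "x = v$1"
    have x: "x > 0" using v e memC by (auto simp: x_def)
    define \<zeta> where "\<zeta> = z v"
    define u where "u = b - 1/\<zeta>\<^sup>2"
    define w where "w = deriv H \<zeta> - b"
    have cx: "\<zeta> * cnj \<zeta> = of_real (x\<^sup>2)" "\<zeta> \<noteq> 0"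
      using cz[of v] x by (auto simp: complex_norm_square[symmetric] \<zeta>_def x_def)
    have i: "cnj (1/\<zeta>\<^sup>2) = \<zeta>\<^sup>2 / of_real x^4"
    proof -
      have "(\<zeta> * cnj \<zeta>)\<^sup>2 = of_real x ^ 4" unfolding cx by (simp flip: power_mult)
      then have "\<zeta>\<^sup>2 * (cnj \<zeta>)\<^sup>2 = of_real x ^ 4" by (simp only: power_mult_distrib)
      then show ?thesis using cx(2) x by (simp add: field_simps)
    qed
    \<comment> \<open>Dropping the square of \<open>w\<close> leaves a harmonic error term, which integrates to \<open>0\<close>.\<close>
    have "(cmod (u + w))\<^sup>2 = (cmod u)\<^sup>2 + 2 * Re (cnj u * w) + (cmod w)\<^sup>2"
      unfolding cmod_power2 by (simp add: power2_eq_square algebra_simps)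
    then have 1: "(cmod (u + w))\<^sup>2 \<ge> (cmod u)\<^sup>2 + 2 * Re (cnj u * w)" by simp
    have "(cmod (b - p))\<^sup>2 = (cmod b)\<^sup>2 + (cmod p)\<^sup>2 - 2 * Re (b * cnj p)" for p
      unfolding cmod_power2 by (simp add: power2_eq_square algebra_simps)
    then have 2: "(cmod u)\<^sup>2 = (cmod b)\<^sup>2 + (cmod (1/\<zeta>\<^sup>2))\<^sup>2 - 2 * Re (b * cnj (1/\<zeta>\<^sup>2))"
      unfolding u_def .
    have 3: "(cmod (1/\<zeta>\<^sup>2))\<^sup>2 = 1/x^4"
      using cz[of v] x by (simp add: \<zeta>_def x_def norm_divide norm_power power_divide flip: power_mult)
    have cu: "cnj u = cnj b - \<zeta>\<^sup>2 / of_real x^4" unfolding u_def complex_cnj_diff i ..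
    have "Re (E x \<zeta>) = Re (cnj u * w) - Re (b * cnj (1/\<zeta>\<^sup>2))"
      unfolding cu i E_def w_def by simp
    then have "1/x^4 + (cmod b)\<^sup>2 + 2 * Re (E x \<zeta>) \<le> (cmod (u + w))\<^sup>2"
      using 1 2 3 by linarith
    then have "x * (1/x^4 + (cmod b)\<^sup>2 + 2 * Re (E x \<zeta>)) \<le> x * (cmod (u + w))\<^sup>2"
      using x by (intro mult_left_mono) auto
    moreover have "u + w = G' \<zeta>" by (simp add: u_def w_def G'_def)
    ultimately show ?thesis
      unfolding J_def f_def by (simp add: x_def \<zeta>_def algebra_simps z_def)
  qed
  have "pi * (1/e\<^sup>2 - 1/\<rho>\<^sup>2 + (cmod b)\<^sup>2 * (\<rho>\<^sup>2 - e\<^sup>2)) \<le> integral (cbox (vector [e,0]) (vector [\<rho>,2*pi])) J"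
    using has_integral_le[OF fI integrable_integral[OF integrable_continuous[OF contJ]]] fJ by blast
  with le show ?thesis unfolding area b_def by linarith
qed


text \<open>
  The complement of a compact convex set \<open>K\<close> that contains the image of the small circle is
  connected, so it is covered by the image of the small punctured disk, and injectivity leaves
  \<open>K\<close> as the only place for the rest of the image.
\<close>

lemma image_outside_circle_subset_convex:
  assumes H: "H holomorphic_on ball 0 1" and inj: "inj_on (\<lambda>z. 1/z + H z) (ball 0 1 - {0})"
    and e: "0 < e" "e < 1"
    and K: "compact K" "convex K" "\<And>z. cmod z = e \<Longrightarrow> 1/z + H z \<in> K"
    and z: "e \<le> cmod z" "cmod z < 1"
  shows "1/z + H z \<in> K"
proof -
  define G where "G = (\<lambda>z. 1/z + H z)"
  define P where "P = ball 0 e - {0::complex}"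
  have P1: "P \<subseteq> ball 0 1 - {0}" using e by (auto simp: P_def)
  have GH: "G holomorphic_on ball 0 1 - {0}"
    unfolding G_def by (intro holomorphic_intros holomorphic_on_subset[OF H]) auto
  have oP: "open (G ` P)"
    using holomorphic_on_subset[OF GH P1] inj_on_subset[OF inj P1]
    by (intro open_mapping_thm3) (auto simp: P_def G_def open_Diff)
  \<comment> \<open>The pole at 0 drives \<open>G\<close> out of every bounded set.\<close>
  have far: "\<exists>d>0. d < e \<and> (\<forall>z. z \<noteq> 0 \<and> cmod z < d \<longrightarrow> cmod (G z) > B)" for B
  proof -
    have "bounded (H ` cball 0 e)"
      using e by (intro compact_imp_bounded compact_continuous_image holomorphic_on_imp_continuous_on
          holomorphic_on_subset[OF H]) auto
    then obtain M where M: "M > 0" "\<And>z. cmod z \<le> e \<Longrightarrow> cmod (H z) \<le> M"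
      by (auto simp: bounded_pos)
    define d where "d = min (e/2) (1 / (\<bar>B\<bar> + M + 1))"
    have d: "d > 0" "d < e" using e M by (auto simp: d_def)
    moreover have "cmod (G z) > B" if z: "z \<noteq> 0" "cmod z < d" for z
    proof -
      have "cmod z < 1 / (\<bar>B\<bar> + M + 1)" using z by (simp add: d_def)
      then have "cmod (1/z) > \<bar>B\<bar> + M + 1"
        using z M by (simp add: norm_divide field_simps)
      moreover have "cmod (H z) \<le> M" using z d by (intro M) auto
      moreover have "cmod (1/z) \<le> cmod (G z) + cmod (H z)"
        unfolding G_def using norm_triangle_ineq4[of "1/z + H z" "H z"] by simp
      ultimately show ?thesis by linarith
    qed
    ultimately show ?thesis by blast
  qed
  obtain BK where BK: "\<And>w. w \<in> K \<Longrightarrow> cmod w \<le> BK"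
    using compact_imp_bounded[OF K(1)] by (auto simp: bounded_iff)
  have ne: "G ` P \<inter> - K \<noteq> {}"
  proof -
    obtain d where d: "d > 0" "d < e" "\<And>z. z \<noteq> 0 \<Longrightarrow> cmod z < d \<Longrightarrow> cmod (G z) > BK"
      using far[of BK] by blast
    have "cmod (G (of_real (d/2))) > BK" using d by (intro d(3)) auto
    then have "G (of_real (d/2)) \<in> - K" using BK by fastforce
    moreover have "of_real (d/2) \<in> P" using d by (auto simp: P_def)
    ultimately show ?thesis by blast
  qed
  \<comment> \<open>Preimages of a convergent sequence accumulate at some \<open>l\<close> in the
    closed disk of radius \<open>e\<close>. The pole excludes \<open>l = 0\<close>, and
    \<open>cmod l = e\<close> would put the limit into \<open>K\<close>, so \<open>l\<close> lies in
    \<open>P\<close>.\<close>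
  have cl: "closedin (top_of_set (- K)) (G ` P \<inter> - K)"
    unfolding closedin_limpt
  proof (intro conjI allI impI)
    fix w assume w: "w islimpt (G ` P \<inter> - K) \<and> w \<in> - K"
    then obtain s where s: "\<And>n::nat. s n \<in> G ` P" "s \<longlonglongrightarrow> w"
      using islimpt_sequential[of w "G ` P \<inter> - K"] by auto
    then have "\<forall>n. \<exists>y. y \<in> P \<and> s n = G y" by blast
    then obtain x where x: "\<And>n. x n \<in> P" "\<And>n. s n = G (x n)" by metis
    have xe: "\<forall>n. x n \<in> cball 0 e" using x(1) by (auto simp: P_def less_imp_le)
    obtain l \<sigma> where l: "l \<in> cball 0 e" "strict_mono (\<sigma>::nat\<Rightarrow>nat)" "(x \<circ> \<sigma>) \<longlonglongrightarrow> l"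
      using compact_cball[of "0::complex" e, unfolded compact_def, THEN spec[of _ x], THEN mp, OF xe] by auto
    have Gs: "(\<lambda>n. G (x (\<sigma> n))) \<longlonglongrightarrow> w"
      using LIMSEQ_subseq_LIMSEQ[OF s(2) l(2)] by (simp add: x(2) o_def)
    have "l \<noteq> 0"
    proof
      assume "l = 0"
      obtain d where d: "d > 0" "\<And>z. z \<noteq> 0 \<Longrightarrow> cmod z < d \<Longrightarrow> cmod (G z) > cmod w + 1"
        using far[of "cmod w + 1"] by blast
      have "\<forall>\<^sub>F n in sequentially. cmod (x (\<sigma> n)) < d"
        using l(3) d(1) unfolding \<open>l = 0\<close> tendsto_iff by (auto simp: dist_norm)
      moreover have "\<forall>\<^sub>F n in sequentially. cmod (G (x (\<sigma> n)) - w) < 1"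
        using tendstoD[OF Gs, of 1] by (simp add: dist_norm)
      ultimately have "\<forall>\<^sub>F n in sequentially. False"
      proof eventually_elim
        case (elim n)
        have "x (\<sigma> n) \<noteq> 0" using x(1) by (auto simp: P_def)
        from d(2)[OF this elim(1)] elim(2) norm_triangle_ineq2[of "G (x (\<sigma> n))" w] show ?case by linarith
      qed
      then show False by simp
    qed
    moreover have "l \<in> ball 0 1" using l e by auto
    ultimately have "isCont G l"
      using holomorphic_on_imp_continuous_on[OF GH] \<open>l \<noteq> 0\<close>
      by (simp add: continuous_on_eq_continuous_at open_Diff)
    then have "(\<lambda>n. G (x (\<sigma> n))) \<longlonglongrightarrow> G l"
      using isCont_tendsto_compose[OF _ l(3)] by (simp add: o_def)
    then have "w = G l" using Gs LIMSEQ_unique by blast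
    moreover have "cmod l \<noteq> e" using \<open>w = G l\<close> w K(3)[of l] by (auto simp: G_def)
    ultimately show "w \<in> G ` P \<inter> - K" using w l \<open>l \<noteq> 0\<close> by (auto simp: P_def)
  qed auto
  have "connected (- K)"
    using K(1,2) by (intro connected_complement_bounded_convex compact_imp_bounded) auto
  moreover have "openin (top_of_set (- K)) (G ` P \<inter> - K)"
    using openin_open_Int[OF oP, of "- K"] by (simp add: Int_commute)
  ultimately have "G ` P \<inter> - K = - K"
    using connected_clopen[of "- K", THEN iffD1, rule_format, of "G ` P \<inter> - K"] cl ne by simp
  then have cov: "- K \<subseteq> G ` P" by blast
  show ?thesis
  proof (rule ccontr)
    assume "1/z + H z \<notin> K"
    then have "G z \<in> - K" by (simp add: G_def)
    then obtain y where y: "y \<in> P" "G z = G y" using cov by blast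
    have "z \<in> ball 0 1 - {0}" using z e by auto
    moreover have "y \<in> ball 0 1 - {0}" using y(1) P1 by blast
    ultimately have "z = y" using inj_onD[OF inj, of z y] y(2) by (simp add: G_def)
    then show False using y z by (auto simp: P_def)
  qed
qed

section \<open>The area theorem\<close>

text \<open>
  On the circle of radius \<open>e\<close> the principal part \<open>1/z + b z\<close> is the real-linear function
  \<open>w + b e\<^sup>2 cnj w\<close> of \<open>w = 1/z\<close>. So the circle is mapped into an ellipse whose area exceeds
  \<open>\<pi> / e\<^sup>2\<close> only by \<open>O(e)\<close>; a surrounding disk would leave an excess that does not vanish.
\<close>

theorem area_theorem:
  assumes H: "H holomorphic_on ball 0 1" and inj: "inj_on (\<lambda>z. 1/z + H z) (ball 0 1 - {0})"
  shows "cmod (deriv H 0) \<le> 1"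
proof -
  define b where "b = deriv H 0"
  have dH: "(deriv ^^ n) H holomorphic_on ball 0 1" for n
    by (rule holomorphic_higher_deriv[OF H]) auto
  have "bounded ((deriv ^^ 2) H ` cball 0 (1/2))"
    by (intro compact_imp_bounded compact_continuous_image holomorphic_on_imp_continuous_on
          holomorphic_on_subset[OF dH]) auto
  then obtain C where C: "C > 0" "\<And>z. cmod z \<le> 1/2 \<Longrightarrow> cmod ((deriv ^^ 2) H z) \<le> C"
    by (auto simp: bounded_pos)
  have err: "cmod (H z - H 0 - b * z) \<le> C * (cmod z)\<^sup>2" if z: "cmod z \<le> 1/2" for z
  proof -
    have "cmod ((deriv ^^ 0) H z - (\<Sum>i\<le>1. (deriv ^^ i) H 0 * (z - 0) ^ i / fact i))
       \<le> C * cmod (z - 0) ^ Suc 1 / fact 1"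
    proof (rule complex_Taylor[of "cball 0 (1/2)"])
      fix i x assume "x \<in> cball (0::complex) (1/2)"
      then have "x \<in> ball 0 1" by auto
      from holomorphic_derivI[OF dH open_ball this, of i]
      show "((deriv ^^ i) H has_field_derivative (deriv ^^ Suc i) H x) (at x within cball 0 (1/2))"
        by (auto intro: has_field_derivative_at_within)
    qed (use C z in \<open>auto simp: numeral_2_eq_2\<close>)
    then show ?thesis by (simp add: b_def diff_diff_eq power2_eq_square)
  qed
  have main: "(cmod b)\<^sup>2 * (\<rho>\<^sup>2 - e\<^sup>2) - 1/\<rho>\<^sup>2 \<le> 4*C*e + 4*C\<^sup>2*e^4"
    if e: "0 < e" "e < \<rho>" "\<rho> < 1" "e \<le> 1/2" "cmod b * e\<^sup>2 \<le> 1/2" for e \<rho>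
  proof -
    define \<beta> where "\<beta> = b * of_real (e\<^sup>2)"
    define T where "T = (\<lambda>w. w + \<beta> * cnj w)"
    \<comment> \<open>The Taylor remainder on the circle is at most \<open>C * e\<^sup>2\<close>;
      pulling it back through \<open>T\<close> at most doubles it because
      \<open>cmod \<beta> \<le> 1/2\<close>.\<close>
    define R where "R = 1/e + 2*C*e\<^sup>2"
    define K where "K = (\<lambda>w. H 0 + T w) ` cball 0 R"
    have \<beta>: "cmod \<beta> \<le> 1/2" using e by (simp add: \<beta>_def norm_mult norm_power)
    have R: "R \<ge> 0" using e C by (simp add: R_def)
    have lin: "linear T"
      unfolding T_def by (rule linearI) (auto simp: algebra_simps scaleR_conv_of_real)
    have "K = (\<lambda>v. H 0 + v) ` T ` cball 0 R" by (simp add: K_def image_image)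
    moreover have "convex (T ` cball 0 R)" "compact (T ` cball 0 R)"
      by (auto intro!: convex_linear_image[OF lin] compact_continuous_image linear_continuous_on
           simp: linear_conv_bounded_linear[symmetric] lin)
    ultimately have K: "convex K" "compact K"
      by (auto intro: convex_translation compact_translation)
    have circ: "1/z + H z \<in> K" if z: "cmod z = e" for z
    proof -
      define d where "d = H z - H 0 - b * z"
      \<comment> \<open>The solution of \<open>T w = d\<close>, obtained by eliminating
        \<open>cnj w\<close> from the equation and its conjugate.\<close>
      define w where "w = (d - \<beta> * cnj d) / of_real (1 - (cmod \<beta>)\<^sup>2)"
      have d: "cmod d \<le> C * e\<^sup>2" using err[of z] z e by (simp add: d_def)
      have pos: "1 - (cmod \<beta>)\<^sup>2 > 0" using \<beta> by (simp add: power_less_one_iff)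
      have "cmod (d - \<beta> * cnj d) \<le> cmod d * (1 + cmod \<beta>)"
        using norm_triangle_ineq4[of d "\<beta> * cnj d"] by (simp add: norm_mult algebra_simps)
      also have "\<dots> \<le> cmod d * (2 * (1 - (cmod \<beta>)\<^sup>2))"
      proof (rule mult_left_mono)
        have "(1 + cmod \<beta>) * 1 \<le> (1 + cmod \<beta>) * (2 * (1 - cmod \<beta>))"
          using \<beta> by (intro mult_left_mono) auto
        then show "1 + cmod \<beta> \<le> 2 * (1 - (cmod \<beta>)\<^sup>2)"
          by (simp add: power2_eq_square algebra_simps)
      qed simp
      finally have "cmod w \<le> 2 * cmod d"
        unfolding w_def norm_divide using pos by (simp add: divide_simps algebra_simps abs_of_pos del: of_real_diff)
      then have wR: "1/z + w \<in> cball 0 R"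
        using norm_triangle_ineq[of "1/z" w] d z e by (simp add: R_def norm_divide)
      have "T w = d"
      proof -
        define s where "s = 1 - (cmod \<beta>)\<^sup>2"
        have s: "s \<noteq> 0" using pos by (simp add: s_def)
        have "T w = (d - \<beta> * cnj d + \<beta> * (cnj d - cnj \<beta> * d)) / of_real s"
          unfolding T_def w_def s_def[symmetric] using s by (simp add: field_simps)
        also have "d - \<beta> * cnj d + \<beta> * (cnj d - cnj \<beta> * d) = of_real s * d"
          using complex_norm_square[of \<beta>] by (simp add: s_def algebra_simps)
        finally show ?thesis using s by simp
      qed
      moreover have "T (1/z) = 1/z + b * z"
      proof -
        have "of_real (e\<^sup>2) = z * cnj z" using z complex_norm_square[of z] by simp
        moreover have "z \<noteq> 0" using z e by auto
        ultimately show ?thesis unfolding T_def \<beta>_def by simp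
      qed
      ultimately have "T (1/z + w) = 1/z + b * z + d" using linear_add[OF lin] by metis
      then have "1/z + H z = H 0 + T (1/z + w)" by (simp add: d_def)
      then show ?thesis unfolding K_def using wR by blast
    qed
    have sub: "1/z + H z \<in> K" if "e \<le> cmod z" "cmod z < 1" for z
      using image_outside_circle_subset_convex[OF H inj _ _ K(2,1) circ that] e by auto
    have "pi * (1/e\<^sup>2 - 1/\<rho>\<^sup>2 + (cmod b)\<^sup>2 * (\<rho>\<^sup>2 - e\<^sup>2)) \<le> measure lebesgue (c2v ` K)"
      unfolding b_def
      by (rule area_of_annulus_image_ge[OF H inj e(1-3)])
        (use sub measure_ellipse(1)[OF R, of \<beta> "H 0"] \<beta> in \<open>auto simp: K_def T_def\<close>)
    also have "\<dots> \<le> pi * R\<^sup>2"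
      using measure_ellipse(2)[OF R, of \<beta> "H 0"] \<beta> by (simp add: K_def T_def)
    finally have "1/e\<^sup>2 - 1/\<rho>\<^sup>2 + (cmod b)\<^sup>2 * (\<rho>\<^sup>2 - e\<^sup>2) \<le> R\<^sup>2" by simp
    also have "R\<^sup>2 = 1/e\<^sup>2 + 4*C*e + 4*C\<^sup>2*e^4"
      unfolding R_def using e by (simp add: field_simps power2_eq_square eval_nat_numeral)
    finally show ?thesis by simp
  qed
  \<comment> \<open>The terms 1/e^2 have cancelled in \<open>main\<close>, so e can tend to 0 with
    \<rho> fixed; only afterwards does \<rho> tend to 1.\<close>
  have lim1: "(cmod b)\<^sup>2 * \<rho>\<^sup>2 - 1/\<rho>\<^sup>2 \<le> 0" if \<rho>: "0 < \<rho>" "\<rho> < 1" for \<rho>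
  proof (rule tendsto_le)
    show "((\<lambda>e. 4*C*e + 4*C\<^sup>2*e^4) \<longlongrightarrow> 0) (at_right 0)"
      by (auto intro!: tendsto_eq_intros)
    show "((\<lambda>e. (cmod b)\<^sup>2 * (\<rho>\<^sup>2 - e\<^sup>2) - 1/\<rho>\<^sup>2) \<longlongrightarrow> (cmod b)\<^sup>2 * \<rho>\<^sup>2 - 1/\<rho>\<^sup>2) (at_right 0)"
      by (auto intro!: tendsto_eq_intros)
    have "((\<lambda>e. cmod b * e\<^sup>2) \<longlongrightarrow> 0) (at_right 0)"
      by (auto intro!: tendsto_eq_intros)
    then have "\<forall>\<^sub>F e in at_right 0. cmod b * e\<^sup>2 < 1/2"
      by (rule order_tendstoD) auto
    moreover have "\<forall>\<^sub>F e in at_right 0. e \<in> {0<..<min \<rho> (1/2)}"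
      by (rule eventually_at_right_real) (use \<rho> in auto)
    ultimately show "\<forall>\<^sub>F e in at_right 0. (cmod b)\<^sup>2 * (\<rho>\<^sup>2 - e\<^sup>2) - 1/\<rho>\<^sup>2 \<le> 4*C*e + 4*C\<^sup>2*e^4"
      by eventually_elim (rule main, use \<rho> in auto)
  qed auto
  have "(cmod b)\<^sup>2 * 1\<^sup>2 - 1/1\<^sup>2 \<le> (0::real)"
  proof (rule tendsto_le)
    show "((\<lambda>\<rho>. (cmod b)\<^sup>2 * \<rho>\<^sup>2 - 1/\<rho>\<^sup>2) \<longlongrightarrow> (cmod b)\<^sup>2 * 1\<^sup>2 - 1/1\<^sup>2) (at_left 1)"
      by (intro tendsto_intros) auto
    have "\<forall>\<^sub>F \<rho> in at_left 1. \<rho> \<in> {0<..<1::real}"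
      by (rule eventually_at_left_real) auto
    then show "\<forall>\<^sub>F \<rho> in at_left 1. (cmod b)\<^sup>2 * \<rho>\<^sup>2 - 1/\<rho>\<^sup>2 \<le> 0"
      by eventually_elim (use lim1 in auto)
  qed auto
  then show ?thesis by (simp add: b_def power_le_one_iff abs_square_le_1)
qed

section \<open>Coefficient and distortion bounds\<close>

text \<open>
  The area theorem is applied to \<open>1/z + z k(z\<^sup>2)\<close>, a constant multiple of a branch of
  \<open>1 / sqrt (\<phi>(z\<^sup>2) - \<phi>(0))\<close>.
\<close>

lemma bieberbach_second_coefficient:
  fixes \<phi> :: "complex \<Rightarrow> complex"
  assumes \<phi>: "\<phi> holomorphic_on ball 0 1" and inj: "inj_on \<phi> (ball 0 1)"
  shows "cmod (deriv (deriv \<phi>) 0) \<le> 4 * cmod (deriv \<phi> 0)"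
proof -
  have "(\<lambda>z. \<phi> z - \<phi> 0) holomorphic_on ball 0 1" by (intro holomorphic_intros \<phi>)
  then obtain h where h: "h holomorphic_on ball 0 1" "\<And>z. cmod z < 1 \<Longrightarrow> \<phi> z - \<phi> 0 = z * h z"
    by (rule Schwarz3) auto
  have dh: "(h has_field_derivative deriv h z) (at z)" if "cmod z < 1" for z
    by (rule holomorphic_derivI[OF h(1)]) (use that in auto)
  have dh': "(deriv h has_field_derivative deriv (deriv h) 0) (at 0)"
    by (rule holomorphic_derivI[OF holomorphic_deriv[OF h(1)]]) auto
  have d1: "deriv \<phi> z = h z + z * deriv h z" if z: "cmod z < 1" for z
  proof -
    have "((\<lambda>z. \<phi> 0 + z * h z) has_field_derivative (h z + z * deriv h z)) (at z)"
      by (auto intro!: derivative_eq_intros dh[OF z])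
    then have "(\<phi> has_field_derivative (h z + z * deriv h z)) (at z)"
      by (rule has_field_derivative_transform_within_open[of _ _ _ "ball 0 1"])
        (use z in \<open>auto simp flip: h(2)\<close>)
    then show ?thesis by (rule DERIV_imp_deriv)
  qed
  have d2: "deriv (deriv \<phi>) 0 = 2 * deriv h 0"
  proof -
    have "((\<lambda>z. h z + z * deriv h z) has_field_derivative (2 * deriv h 0)) (at 0)"
      by (auto intro!: derivative_eq_intros dh dh')
    then have "(deriv \<phi> has_field_derivative (2 * deriv h 0)) (at 0)"
      by (rule has_field_derivative_transform_within_open[of _ _ _ "ball 0 1"]) (use d1 in auto)
    then show ?thesis by (rule DERIV_imp_deriv)
  qed
  have "deriv \<phi> 0 \<noteq> 0"
    by (rule holomorphic_injective_imp_regular[OF \<phi> _ inj]) auto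
  then have h0: "h 0 \<noteq> 0" using d1[of 0] by simp
  have hnz: "h z \<noteq> 0" if "z \<in> ball 0 1" for z
  proof (cases "z = 0")
    case False
    then have "\<phi> z \<noteq> \<phi> 0" using inj that by (auto dest: inj_onD)
    then show ?thesis using h(2)[of z] that by auto
  qed (use h0 in simp)
  obtain g where g: "g holomorphic_on ball 0 1" "\<And>z. z \<in> ball 0 1 \<Longrightarrow> exp (g z) = h z"
    by (rule holomorphic_logarithm_exists[OF convex_ball open_ball h(1) hnz, of 0]) auto
  have dg: "(g has_field_derivative deriv g 0) (at 0)"
    by (rule holomorphic_derivI[OF g(1)]) auto
  have h'0: "deriv h 0 = h 0 * deriv g 0"
  proof -
    have "((\<lambda>z. exp (g z)) has_field_derivative (exp (g 0) * deriv g 0)) (at 0)"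
      by (auto intro!: derivative_eq_intros dg)
    then have "(h has_field_derivative (exp (g 0) * deriv g 0)) (at 0)"
      by (rule has_field_derivative_transform_within_open[of _ _ _ "ball 0 1"]) (use g(2) in auto)
    then show ?thesis using g(2)[of 0] by (simp add: DERIV_imp_deriv)
  qed
  \<comment> \<open>The branch of the square root of \<open>h 0 / h z\<close> with value 1 at the
    origin, so that \<open>T (z\<^sup>2) / z\<close> has principal part exactly
    \<open>1/z\<close>.\<close>
  define T where "T = (\<lambda>z. exp ((g 0 - g z) / 2))"
  have T: "(\<lambda>z. T z - 1) holomorphic_on ball 0 1"
    unfolding T_def by (intro holomorphic_intros g) auto
  obtain k where k: "k holomorphic_on ball 0 1" "\<And>z. cmod z < 1 \<Longrightarrow> T z - 1 = z * k z"
      "deriv (\<lambda>z. T z - 1) 0 = k 0"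
    by (rule Schwarz3[OF T]) (auto simp: T_def)
  have "((\<lambda>z. T z - 1) has_field_derivative (- deriv g 0 / 2)) (at 0)"
    unfolding T_def by (auto intro!: derivative_eq_intros dg)
  then have k0: "k 0 = - deriv g 0 / 2" using k(3) DERIV_imp_deriv by metis
  define H where "H = (\<lambda>z. z * k (z\<^sup>2))"
  have sq: "z\<^sup>2 \<in> ball 0 1" if "z \<in> ball 0 1" for z :: complex
    using that by (simp add: norm_power power_less_one_iff)
  have k2: "(\<lambda>z. k (z\<^sup>2)) holomorphic_on ball 0 1"
    using holomorphic_on_compose_gen[of "\<lambda>z. z\<^sup>2" "ball 0 1" k "ball 0 1", unfolded o_def, OF _ k(1)] sq
    by (simp add: image_subset_iff holomorphic_on_power)
  have Hh: "H holomorphic_on ball 0 1"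
    unfolding H_def by (intro holomorphic_intros k2)
  have GT: "1/z + H z = T (z\<^sup>2) / z" if "z \<in> ball 0 1 - {0}" for z
    using k(2)[of "z\<^sup>2"] sq[of z] that by (auto simp: H_def field_simps power2_eq_square)
  have GT2: "(1/z + H z)\<^sup>2 = h 0 / (\<phi> (z\<^sup>2) - \<phi> 0)" if z: "z \<in> ball 0 1 - {0}" for z
  proof -
    have "(T (z\<^sup>2))\<^sup>2 = exp (g 0 - g (z\<^sup>2))"
      by (simp add: T_def power2_eq_square flip: exp_add)
    also have "\<dots> = h 0 / h (z\<^sup>2)" using g(2) sq z by (simp add: exp_diff)
    finally show ?thesis using GT[OF z] h(2)[of "z\<^sup>2"] sq[of z] z
      by (auto simp: power_divide field_simps)
  qed
  have "inj_on (\<lambda>z. 1/z + H z) (ball 0 1 - {0})"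
  proof (rule inj_onI)
    fix z w assume zw: "z \<in> ball 0 1 - {0}" "w \<in> ball 0 1 - {0}" "1/z + H z = 1/w + H w"
    then have "h 0 / (\<phi> (z\<^sup>2) - \<phi> 0) = h 0 / (\<phi> (w\<^sup>2) - \<phi> 0)"
      using GT2[of z] GT2[of w] by metis
    moreover have "\<phi> (z\<^sup>2) \<noteq> \<phi> 0" "\<phi> (w\<^sup>2) \<noteq> \<phi> 0"
      using zw sq[of z] sq[of w] inj_onD[OF inj, of "z\<^sup>2" 0] inj_onD[OF inj, of "w\<^sup>2" 0] by auto
    ultimately have "\<phi> (z\<^sup>2) = \<phi> (w\<^sup>2)" using h0 by auto
    then have "z\<^sup>2 = w\<^sup>2" using inj_onD[OF inj, of "z\<^sup>2" "w\<^sup>2"] sq zw by blast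
    \<comment> \<open>Only the sign of \<open>z\<close> is still open. The function is odd, its even
      factor \<open>T (z\<^sup>2)\<close> being common to both sides and nonzero, and this decides
      the sign.\<close>
    then have "T (z\<^sup>2) / z = T (z\<^sup>2) / w" using GT[of z] GT[of w] zw by metis
    then show "z = w" using zw by (auto simp: T_def field_simps)
  qed
  from area_theorem[OF Hh this] have "cmod (deriv H 0) \<le> 1" .
  moreover have "deriv H 0 = k 0"
  proof -
    have "((\<lambda>z. k (z\<^sup>2)) has_field_derivative deriv (\<lambda>z. k (z\<^sup>2)) 0) (at 0)"
      by (rule holomorphic_derivI[OF k2]) auto
    then have "(H has_field_derivative k 0) (at 0)"
      unfolding H_def by (auto intro!: derivative_eq_intros)
    then show ?thesis by (rule DERIV_imp_deriv)
  qed
  ultimately have "cmod (deriv g 0) \<le> 2" using k0 by (simp add: norm_divide)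
  then have "cmod (h 0) * cmod (deriv g 0) \<le> cmod (h 0) * 2" by (intro mult_left_mono) auto
  then show ?thesis using d2 h'0 d1[of 0] by (simp add: norm_mult)
qed

section \<open>Disk automorphisms, distortion of univalent functions, and the Schwarz-Pick
  inequality\<close>

lemma Moebius_denominator_nonzero:
  assumes "cmod c < 1" "cmod w < 1"
  shows "1 - cnj c * w \<noteq> 0"
proof
  assume "1 - cnj c * w = 0"
  then have "cmod (cnj c * w) = 1" by simp
  moreover have "cmod (cnj c * w) < 1 * 1"
    unfolding norm_mult using assms by (intro mult_strict_mono') auto
  ultimately show False by simp
qed

lemma has_field_derivative_Moebius:
  assumes "cmod c < 1" "cmod w < 1"
  shows "(Moebius_function 0 c has_field_derivative (1 - (cmod c)\<^sup>2) / (1 - cnj c * w)\<^sup>2) (at w)"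
proof -
  have nz: "1 - cnj c * w \<noteq> 0" using assms by (rule Moebius_denominator_nonzero)
  have "((\<lambda>z. (z - c) / (1 - cnj c * z)) has_field_derivative (1 - (cmod c)\<^sup>2) / (1 - cnj c * w)\<^sup>2) (at w)"
    using nz complex_norm_square[of c]
    by (auto intro!: derivative_eq_intros simp: power2_eq_square[of "1 - cnj c * w"]) (simp add: algebra_simps)
  then show ?thesis unfolding Moebius_function_simple[abs_def] .
qed

text \<open>The Koebe transform: Bieberbach's bound is applied to \<phi> composed with the
  automorphism that takes 0 to \<open>a\<close>. That bound assumes no normalisation, so the
  composition needs no rescaling, and the common factor 1 - |a|^2 cancels.\<close>

lemma koebe_second_derivative:
  fixes \<phi> :: "complex \<Rightarrow> complex"
  assumes \<phi>: "\<phi> holomorphic_on ball 0 1" and inj: "inj_on \<phi> (ball 0 1)" and a: "cmod a < 1"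
  shows "cmod ((1 - (cmod a)\<^sup>2) * deriv (deriv \<phi>) a - 2 * cnj a * deriv \<phi> a) \<le> 4 * cmod (deriv \<phi> a)"
proof -
  define s where "s = complex_of_real (1 - (cmod a)\<^sup>2)"
  define M where "M = Moebius_function 0 (- a)"
  have Mb: "cmod (M z) < 1" if "cmod z < 1" for z
    unfolding M_def by (rule Moebius_function_norm_lt_1) (use a that in auto)
  have Mh: "M holomorphic_on ball 0 1"
    unfolding M_def by (rule Moebius_function_holomorphic) (use a in auto)
  have dM: "(M has_field_derivative s / (1 + cnj a * z)\<^sup>2) (at z)" if "cmod z < 1" for z
    using has_field_derivative_Moebius[of "-a" z] a that by (simp add: M_def s_def)
  have M0: "M 0 = a" by (simp add: M_def Moebius_function_simple)
  define \<psi> where "\<psi> = \<phi> \<circ> M"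
  have "\<psi> holomorphic_on ball 0 1"
    unfolding \<psi>_def by (rule holomorphic_on_compose_gen[OF Mh \<phi>]) (use Mb in auto)
  moreover have "inj_on \<psi> (ball 0 1)"
    unfolding \<psi>_def
  proof (rule comp_inj_on)
    show "inj_on M (ball 0 1)"
    proof (rule inj_on_inverseI)
      show "Moebius_function 0 a (M z) = z" if "z \<in> ball 0 1" for z
        unfolding M_def by (rule Moebius_function_compose) (use a that in auto)
    qed
    show "inj_on \<phi> (M ` ball 0 1)" by (rule inj_on_subset[OF inj]) (use Mb in auto)
  qed
  ultimately have 1: "cmod (deriv (deriv \<psi>) 0) \<le> 4 * cmod (deriv \<psi> 0)"
    by (rule bieberbach_second_coefficient)
  have d\<psi>: "deriv \<psi> z = deriv \<phi> (M z) * (s / (1 + cnj a * z)\<^sup>2)" if "cmod z < 1" for z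
    unfolding \<psi>_def
    by (intro DERIV_imp_deriv DERIV_chain[OF _ dM[OF that]] holomorphic_derivI[OF \<phi> open_ball])
      (use Mb that in auto)
  have "((\<lambda>z. deriv \<phi> (M z) * (s / (1 + cnj a * z)\<^sup>2)) has_field_derivative
      (s * (s * deriv (deriv \<phi>) a - 2 * cnj a * deriv \<phi> a))) (at 0)"
  proof -
    have "(deriv \<phi> has_field_derivative deriv (deriv \<phi>) (M 0)) (at (M 0))"
      by (rule holomorphic_derivI[OF holomorphic_deriv[OF \<phi>]]) (use M0 a in auto)
    from DERIV_chain2[OF this dM[of 0]]
    have d: "((\<lambda>z. deriv \<phi> (M z)) has_field_derivative deriv (deriv \<phi>) a * s) (at 0)"
      by (simp add: M0)
    show ?thesis
      by (auto intro!: derivative_eq_intros d simp: M0) (simp add: algebra_simps)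
  qed
  then have "(deriv \<psi> has_field_derivative (s * (s * deriv (deriv \<phi>) a - 2 * cnj a * deriv \<phi> a))) (at 0)"
    by (rule has_field_derivative_transform_within_open[of _ _ _ "ball 0 1"]) (use d\<psi> in auto)
  then have "deriv (deriv \<psi>) 0 = s * (s * deriv (deriv \<phi>) a - 2 * cnj a * deriv \<phi> a)"
    by (rule DERIV_imp_deriv)
  moreover have "deriv \<psi> 0 = s * deriv \<phi> a" using d\<psi>[of 0] M0 by simp
  ultimately have "cmod s * cmod (s * deriv (deriv \<phi>) a - 2 * cnj a * deriv \<phi> a) \<le> cmod s * (4 * cmod (deriv \<phi> a))"
    using 1 by (simp add: norm_mult mult.left_commute)
  moreover have "s \<noteq> 0"
    using a abs_square_less_1[of "cmod a"] unfolding s_def of_real_eq_0_iff by simp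
  ultimately show ?thesis by (simp add: s_def)
qed

text \<open>After multiplication by \<open>z / deriv \<phi> z\<close> the previous bound places the
  quotient in the disk with real centre 2r^2 / (1 - r^2) and radius 4r / (1 - r^2); the two bounds
  are the ends of its real diameter.\<close>

lemma koebe_pre_schwarzian:
  fixes \<phi> :: "complex \<Rightarrow> complex"
  assumes \<phi>: "\<phi> holomorphic_on ball 0 1" and inj: "inj_on \<phi> (ball 0 1)" and r: "cmod z = r" "r < 1"
  shows "(2*r\<^sup>2 - 4*r) / (1 - r\<^sup>2) \<le> Re (z * deriv (deriv \<phi>) z / deriv \<phi> z)"
    and "Re (z * deriv (deriv \<phi>) z / deriv \<phi> z) \<le> (2*r\<^sup>2 + 4*r) / (1 - r\<^sup>2)"
proof -
  have r0: "0 \<le> r" using r by auto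
  then have s: "1 - r\<^sup>2 > 0" using r by (simp add: power_less_one_iff abs_square_less_1)
  have nz: "deriv \<phi> z \<noteq> 0"
    by (rule holomorphic_injective_imp_regular[OF \<phi> _ inj]) (use r in auto)
  define q where "q = z * deriv (deriv \<phi>) z / deriv \<phi> z"
  have zz: "z * cnj z = of_real (r\<^sup>2)" using r complex_norm_square[of z] by simp
  have "z * ((1 - (cmod z)\<^sup>2) * deriv (deriv \<phi>) z - 2 * cnj z * deriv \<phi> z)
      = ((1 - of_real r^2) * q - 2 * (z * cnj z)) * deriv \<phi> z"
    using nz r by (simp add: q_def field_simps)
  then have "cmod z * cmod ((1 - (cmod z)\<^sup>2) * deriv (deriv \<phi>) z - 2 * cnj z * deriv \<phi> z)
      = cmod (of_real (1 - r\<^sup>2) * q - of_real (2 * r\<^sup>2)) * cmod (deriv \<phi> z)"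
    unfolding zz norm_mult[symmetric] by simp
  moreover have "cmod z * cmod ((1 - (cmod z)\<^sup>2) * deriv (deriv \<phi>) z - 2 * cnj z * deriv \<phi> z)
      \<le> r * (4 * cmod (deriv \<phi> z))"
    unfolding r(1) using koebe_second_derivative[OF \<phi> inj, of z] r r0 by (intro mult_left_mono) auto
  ultimately have "cmod (of_real (1 - r\<^sup>2) * q - of_real (2 * r\<^sup>2)) * cmod (deriv \<phi> z) \<le> (4 * r) * cmod (deriv \<phi> z)"
    by simp
  then have "cmod (of_real (1 - r\<^sup>2) * q - of_real (2 * r\<^sup>2)) \<le> 4 * r"
    using nz by simp
  then have "\<bar>Re (of_real (1 - r\<^sup>2) * q - of_real (2 * r\<^sup>2))\<bar> \<le> 4 * r"
    using abs_Re_le_cmod order_trans by blast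
  moreover have "Re (of_real (1 - r\<^sup>2) * q - of_real (2 * r\<^sup>2)) = (1 - r\<^sup>2) * Re q - 2 * r\<^sup>2"
    by (simp only: minus_complex.sel Re_complex_of_real times_complex.sel Im_complex_of_real mult_zero_left diff_zero)
  ultimately have *: "\<bar>(1 - r\<^sup>2) * Re q - 2 * r\<^sup>2\<bar> \<le> 4 * r" by simp
  show "(2*r\<^sup>2 - 4*r) / (1 - r\<^sup>2) \<le> Re (z * deriv (deriv \<phi>) z / deriv \<phi> z)"
    unfolding q_def[symmetric] pos_divide_le_eq[OF s] using * by (simp add: algebra_simps abs_le_iff)
  show "Re (z * deriv (deriv \<phi>) z / deriv \<phi> z) \<le> (2*r\<^sup>2 + 4*r) / (1 - r\<^sup>2)"
    unfolding q_def[symmetric] pos_le_divide_eq[OF s] using * by (simp add: algebra_simps abs_le_iff)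
qed

text \<open>With \<open>L\<close> a logarithm of \<open>deriv \<phi>\<close>, the preceding bound
  controls the radial derivative of \<open>Re L\<close>. Partial fractions turn its two sides into
  the derivatives of ln (1 + s) - 3 ln (1 - s) and ln (1 - s) - 3 ln (1 + s), and integration gives
  the result.\<close>

theorem koebe_distortion:
  fixes \<phi> :: "complex \<Rightarrow> complex"
  assumes \<phi>: "\<phi> holomorphic_on ball 0 1" and inj: "inj_on \<phi> (ball 0 1)" and n: "deriv \<phi> 0 = 1"
    and r: "cmod z = r" "r < 1"
  shows "(1 - r) / (1 + r)^3 \<le> cmod (deriv \<phi> z)" and "cmod (deriv \<phi> z) \<le> (1 + r) / (1 - r)^3"
proof -
  have r0: "0 \<le> r" using r by auto
  have nz: "deriv \<phi> w \<noteq> 0" if "w \<in> ball 0 1" for w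
    by (rule holomorphic_injective_imp_regular[OF \<phi> _ inj]) (use that in auto)
  have \<phi>': "deriv \<phi> holomorphic_on ball 0 1" by (intro holomorphic_deriv \<phi>) auto
  obtain L where L: "L holomorphic_on ball 0 1" "\<And>w. w \<in> ball 0 1 \<Longrightarrow> exp (L w) = deriv \<phi> w"
    by (rule holomorphic_logarithm_exists[OF convex_ball open_ball \<phi>' nz, of 0]) auto
  have dL: "deriv L w = deriv (deriv \<phi>) w / deriv \<phi> w" if w: "w \<in> ball 0 1" for w
  proof -
    have "((\<lambda>z. exp (L z)) has_field_derivative (exp (L w) * deriv L w)) (at w)"
      using w by (auto intro!: derivative_eq_intros holomorphic_derivI[OF L(1)])
    then have "(deriv \<phi> has_field_derivative (exp (L w) * deriv L w)) (at w)"
      by (rule has_field_derivative_transform_within_open[of _ _ _ "ball 0 1"]) (use L(2) w in auto)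
    then have "deriv (deriv \<phi>) w = deriv \<phi> w * deriv L w" using L(2)[OF w] by (simp add: DERIV_imp_deriv)
    then show ?thesis using nz[OF w] by simp
  qed
  define \<zeta> where "\<zeta> = cis (Arg z)"
  have z: "z = of_real r * \<zeta>" using r(1) rcis_cmod_Arg[of z] by (simp add: \<zeta>_def rcis_def)
  define F where "F = (\<lambda>s::real. Re (L (of_real s * \<zeta>)))"
  define F' where "F' = (\<lambda>s::real. Re (\<zeta> * deriv L (of_real s * \<zeta>)))"
  have dF: "(F has_real_derivative F' s) (at s)" if s: "0 \<le> s" "s \<le> r" for s
  proof -
    have b: "of_real s * \<zeta> \<in> ball 0 1" using s r by (simp add: norm_mult \<zeta>_def)
    have "(L has_field_derivative deriv L (of_real s * \<zeta>)) (at (of_real s * \<zeta>))"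
      by (rule holomorphic_derivI[OF L(1) _ b]) auto
    moreover have "((\<lambda>w. w * \<zeta>) has_field_derivative \<zeta>) (at (of_real s))"
      by (auto intro!: derivative_eq_intros)
    ultimately have "((\<lambda>w. L (w * \<zeta>)) has_field_derivative (deriv L (of_real s * \<zeta>) * \<zeta>)) (at (of_real s))"
      by (rule DERIV_chain2)
    then have "((\<lambda>s. L (of_real s * \<zeta>)) has_vector_derivative (deriv L (of_real s * \<zeta>) * \<zeta>)) (at s)"
      by (rule has_vector_derivative_real_field)
    then have "(F has_vector_derivative Re (deriv L (of_real s * \<zeta>) * \<zeta>)) (at s)"
      unfolding F_def by (rule bounded_linear.has_vector_derivative[OF bounded_linear_Re])
    then show ?thesis
      by (simp add: F'_def has_real_derivative_iff_has_vector_derivative mult.commute)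
  qed
  have bnd: "- 1/(1 - s) - 3/(1 + s) \<le> F' s \<and> F' s \<le> 1/(1 + s) + 3/(1 - s)" if s: "0 \<le> s" "s \<le> r" for s
  proof (cases "s = 0")
    case True
    \<comment> \<open>The bound used for s > 0 carries a factor s and says nothing at the centre, so
      Bieberbach's inequality is used directly there.\<close>
    have "cmod (deriv (deriv \<phi>) 0) \<le> 4" using bieberbach_second_coefficient[OF \<phi> inj] n by simp
    then have "\<bar>F' s\<bar> \<le> 4"
      using abs_Re_le_cmod[of "\<zeta> * deriv (deriv \<phi>) 0"] True n dL[of 0]
      by (simp add: F'_def norm_mult \<zeta>_def)
    then show ?thesis using True by auto
  next
    case False
    then have s0: "s > 0" using s by simp
    have s1: "s < 1" using s r by simp
    have "s\<^sup>2 < 1" using s0 s1 by (simp add: abs_square_less_1)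
    have c: "cmod (of_real s * \<zeta>) = s" using s0 by (simp add: norm_mult \<zeta>_def)
    have "of_real s * \<zeta> * deriv (deriv \<phi>) (of_real s * \<zeta>) / deriv \<phi> (of_real s * \<zeta>) = of_real s * (\<zeta> * deriv L (of_real s * \<zeta>))"
      using dL c s1 by simp
    then have "Re (of_real s * \<zeta> * deriv (deriv \<phi>) (of_real s * \<zeta>) / deriv \<phi> (of_real s * \<zeta>)) = s * F' s"
      by (simp only: F'_def Re_complex_of_real times_complex.sel Im_complex_of_real mult_zero_left diff_zero)
    with koebe_pre_schwarzian[OF \<phi> inj c s1]
    have "(2 * s\<^sup>2 - 4 * s) / (1 - s\<^sup>2) \<le> s * F' s" "s * F' s \<le> (2 * s\<^sup>2 + 4 * s) / (1 - s\<^sup>2)" by auto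
    moreover have "(2 * s\<^sup>2 - 4 * s) / (1 - s\<^sup>2) = s * ((2 * s - 4) / (1 - s\<^sup>2))"
      "(2 * s\<^sup>2 + 4 * s) / (1 - s\<^sup>2) = s * ((2 * s + 4) / (1 - s\<^sup>2))" by (simp_all add: power2_eq_square algebra_simps)
    ultimately have "(2 * s - 4) / (1 - s\<^sup>2) \<le> F' s" "F' s \<le> (2 * s + 4) / (1 - s\<^sup>2)"
      using s0 by (simp_all only: mult_le_cancel_left_pos)
    moreover have "(2 * s - 4) / (1 - s\<^sup>2) = - 1/(1 - s) - 3/(1 + s)"
      "(2 * s + 4) / (1 - s\<^sup>2) = 1/(1 + s) + 3/(1 - s)"
      using s0 s1 \<open>s\<^sup>2 < 1\<close> by (auto simp: divide_simps power2_eq_square) (auto simp: algebra_simps)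
    ultimately show ?thesis by simp
  qed
  have F0: "F 0 = 0"
  proof -
    have "exp (L 0) = 1" using L(2)[of 0] n by simp
    then have "cmod (exp (L 0)) = 1" by simp
    then show ?thesis by (simp add: F_def)
  qed
  have Fr: "cmod (deriv \<phi> z) = exp (F r)"
    using L(2)[of z] r by (simp add: F_def z[symmetric] flip: norm_exp_eq_Re)
  have "ln (1 + 0) - 3 * ln (1 - 0) - F 0 \<le> ln (1 + r) - 3 * ln (1 - r) - F r"
  proof (rule DERIV_nonneg_imp_nondecreasing[OF r0])
    fix s assume s: "0 \<le> s" "s \<le> r"
    then have "s < 1" using r by simp
    then have "((\<lambda>s. ln (1 + s) - 3 * ln (1 - s) - F s) has_real_derivative (1/(1 + s) + 3/(1 - s) - F' s)) (at s)"
      using s by (auto intro!: derivative_eq_intros dF)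
    then show "\<exists>y. ((\<lambda>s. ln (1 + s) - 3 * ln (1 - s) - F s) has_real_derivative y) (at s) \<and> 0 \<le> y"
      using bnd[OF s] by (intro exI conjI) auto
  qed
  then have "F r \<le> ln ((1 + r) / (1 - r)^3)"
    using F0 r r0 by (simp add: ln_div ln_realpow)
  then show "cmod (deriv \<phi> z) \<le> (1 + r) / (1 - r)^3"
    unfolding Fr using r r0 by (subst ln_ge_iff[symmetric]) auto
  have "F 0 - (ln (1 - 0) - 3 * ln (1 + 0)) \<le> F r - (ln (1 - r) - 3 * ln (1 + r))"
  proof (rule DERIV_nonneg_imp_nondecreasing[OF r0])
    fix s assume s: "0 \<le> s" "s \<le> r"
    then have "s < 1" using r by simp
    then have "((\<lambda>s. F s - (ln (1 - s) - 3 * ln (1 + s))) has_real_derivative (F' s - (- 1/(1 - s) - 3/(1 + s)))) (at s)"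
      using s by (auto intro!: derivative_eq_intros dF)
    then show "\<exists>y. ((\<lambda>s. F s - (ln (1 - s) - 3 * ln (1 + s))) has_real_derivative y) (at s) \<and> 0 \<le> y"
      using bnd[OF s] by (intro exI conjI) auto
  qed
  then have "ln ((1 - r) / (1 + r)^3) \<le> F r"
    using F0 r r0 by (simp add: ln_div ln_realpow)
  then show "(1 - r) / (1 + r)^3 \<le> cmod (deriv \<phi> z)"
    unfolding Fr using r r0 by (metis exp_le_cancel_iff exp_ln divide_pos_pos zero_less_power add_pos_nonneg diff_gt_0_iff_gt zero_less_one)
qed

text \<open>Automorphisms before and after \<open>w\<close> move \<open>a\<close> and
  \<open>w a\<close> to 0. The Schwarz lemma bounds the derivative of the composite, and the chain
  rule supplies the two factors.\<close>

lemma schwarz_pick_derivative: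
  fixes w :: "complex \<Rightarrow> complex"
  assumes w: "w holomorphic_on ball 0 1" and lt: "\<And>z. cmod z < 1 \<Longrightarrow> cmod (w z) < 1" and a: "cmod a < 1"
  shows "cmod (deriv w a) * (1 - (cmod a)\<^sup>2) \<le> 1 - (cmod (w a))\<^sup>2"
proof -
  define M where "M = Moebius_function 0 (- a)"
  define N where "N = Moebius_function 0 (w a)"
  define F where "F = N \<circ> (w \<circ> M)"
  have Mb: "cmod (M z) < 1" if "cmod z < 1" for z
    unfolding M_def by (rule Moebius_function_norm_lt_1) (use a that in auto)
  have M0: "M 0 = a" by (simp add: M_def Moebius_function_simple)
  have wa: "cmod (w a) < 1" using lt a by simp
  have Fh: "F holomorphic_on ball 0 1"
    unfolding F_def
  proof (intro holomorphic_on_compose_gen[of _ _ _ "ball 0 1"])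
    show "M holomorphic_on ball 0 1"
      unfolding M_def by (rule Moebius_function_holomorphic) (use a in auto)
    show "N holomorphic_on ball 0 1"
      unfolding N_def by (rule Moebius_function_holomorphic) (use wa in auto)
  qed (use w Mb lt in auto)
  have "F 0 = 0" by (simp add: F_def N_def M0 Moebius_function_eq_zero)
  moreover have "cmod (F z) < 1" if "cmod z < 1" for z
    unfolding F_def o_def N_def by (intro Moebius_function_norm_lt_1 wa lt Mb that)
  ultimately have 1: "cmod (deriv F 0) \<le> 1"
    using Schwarz_Lemma(2)[OF Fh, of 0] by simp
  have dM: "(M has_field_derivative (1 - (cmod a)\<^sup>2)) (at 0)"
    using has_field_derivative_Moebius[of "-a" 0] a by (simp add: M_def)
  have dw: "(w has_field_derivative deriv w (M 0)) (at (M 0))"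
    by (rule holomorphic_derivI[OF w]) (use a M0 in auto)
  have pos: "1 - (cmod (w a))\<^sup>2 > 0" "1 - (cmod a)\<^sup>2 > 0" using wa a by (simp_all add: abs_square_less_1)
  have "1 - cnj (w a) * w a = of_real (1 - (cmod (w a))\<^sup>2)"
    using complex_norm_square[of "w a"] by (simp add: mult.commute)
  then have "(N has_field_derivative 1 / of_real (1 - (cmod (w a))\<^sup>2)) (at ((w \<circ> M) 0))"
    using has_field_derivative_Moebius[OF wa wa] pos(1)
    by (simp add: N_def M0 power2_eq_square del: of_real_diff of_real_mult)
  from DERIV_chain[OF this DERIV_chain[OF dw dM]]
  have "(F has_field_derivative (1 / of_real (1 - (cmod (w a))\<^sup>2) * (deriv w a * of_real (1 - (cmod a)\<^sup>2)))) (at 0)"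
    by (simp add: F_def M0)
  then have eq: "cmod (deriv F 0) = cmod (deriv w a) * (1 - (cmod a)\<^sup>2) / (1 - (cmod (w a))\<^sup>2)"
    using pos by (simp add: DERIV_imp_deriv norm_mult norm_divide del: of_real_diff)
  show ?thesis using 1 unfolding eq pos_divide_le_eq[OF pos(1)] by simp
qed

section \<open>Curvature bounds\<close>

lemma dzbar_harmonic:
  assumes h: "h holomorphic_on \<D>" and g: "g holomorphic_on \<D>"
    and f: "\<And>z. z \<in> \<D> \<Longrightarrow> f z = h z + cnj (g z)" and z: "z \<in> \<D>"
  shows "dzbar f z = cnj (deriv g z)"
proof -
  have "(h has_derivative (\<lambda>v. deriv h z * v)) (at z)" "(g has_derivative (\<lambda>v. deriv g z * v)) (at z)"
    using holomorphic_derivI[OF h open_ball z] holomorphic_derivI[OF g open_ball z]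
    by (simp_all add: has_field_derivative_def)
  then have "((\<lambda>z. h z + cnj (g z)) has_derivative (\<lambda>v. deriv h z * v + cnj (deriv g z * v))) (at z)"
    by (intro has_derivative_add has_derivative_cnj)
  then have "(f has_derivative (\<lambda>v. deriv h z * v + cnj (deriv g z * v))) (at z)"
    by (rule has_derivative_transform_within_open[of _ _ _ _ \<D>]) (use f z in auto)
  then have "frechet_derivative f (at z) = (\<lambda>v. deriv h z * v + cnj (deriv g z * v))"
    by (rule frechet_derivative_at[symmetric])
  then show ?thesis by (simp add: dzbar_def algebra_simps)
qed

text \<open>\<open>dzbar f\<close> determines the derivative of the second part, and the value 0 at
  the origin fixes the constant. This is needed because sense preservation and the shear condition
  each assert the existence of a decomposition of their own.\<close>

lemma canonical_parts_unique:
  assumes 1: "canonical_parts f h g" and 2: "canonical_parts f h' g'" and z: "z \<in> \<D>"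
  shows "h z = h' z" and "g z = g' z"
proof -
  have hol: "g holomorphic_on \<D>" "g' holomorphic_on \<D>" using 1 2 by (auto simp: canonical_parts_def)
  have "deriv g w = deriv g' w" if w: "w \<in> \<D>" for w
  proof -
    have "cnj (deriv g w) = cnj (deriv g' w)"
      using 1 2 dzbar_harmonic[of h g f w] dzbar_harmonic[of h' g' f w] w
      by (simp add: canonical_parts_def)
    then show ?thesis by simp
  qed
  then have "((\<lambda>w. g w - g' w) has_field_derivative 0) (at w within \<D>)" if w: "w \<in> \<D>" for w
    using DERIV_diff[OF holomorphic_derivI[OF hol(1) open_ball w] holomorphic_derivI[OF hol(2) open_ball w]] w
    by (simp add: has_field_derivative_at_within)
  then obtain c where "\<And>w. w \<in> \<D> \<Longrightarrow> g w - g' w = c"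
    using has_field_derivative_zero_constant[OF convex_ball, of 0 1 "\<lambda>w. g w - g' w"] by metis
  from this[OF z] this[of 0] have "g z - g' z = g 0 - g' 0" by simp
  then show "g z = g' z" using 1 2 by (simp add: canonical_parts_def)
  moreover have "h z + cnj (g z) = h' z + cnj (g' z)" using 1 2 z by (metis canonical_parts_def)
  ultimately show "h z = h' z" by simp
qed

text \<open>The form in which the class enters all estimates, with \<open>l\<close> in the role of
  e^(i theta). The condition \<open>deriv g 0 = 0\<close> makes the dilatation vanish at 0, which
  lets the Schwarz lemma bound it by the radius.\<close>

definition shear_pair :: "(complex \<Rightarrow> complex) \<Rightarrow> (complex \<Rightarrow> complex) \<Rightarrow> complex \<Rightarrow> bool" where
  "shear_pair h g l \<longleftrightarrow> h holomorphic_on \<D> \<and> g holomorphic_on \<D> \<and> deriv h 0 = 1 \<and> deriv g 0 = 0 \<and> cmod l = 1 \<and>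
     (\<forall>z\<in>\<D>. cmod (deriv g z) < cmod (deriv h z)) \<and> inj_on (\<lambda>z. h z + l * g z) \<D>"

lemma class_SH0_S_shear_pair:
  assumes "f \<in> class_SH0_S"
  obtains h g l where "shear_pair h g l" "\<And>z. z \<in> \<D> \<Longrightarrow> f z = h z + cnj (g z)" "inj_on f \<D>"
proof -
  from assms have f: "sense_preserving f" "inj_on f \<D>" "dzbar f 0 = 0"
    by (auto simp: class_SH0_S_def class_SH0_def class_SH_def)
  from assms obtain h g \<theta> where hg: "canonical_parts f h g"
    and S: "(\<lambda>z. h z + exp (\<i> * of_real \<theta>) * g z) \<in> class_S"
    by (auto simp: class_SH0_S_def)
  have hol: "h holomorphic_on \<D>" "g holomorphic_on \<D>" "deriv h 0 = 1"
    and fz: "\<And>z. z \<in> \<D> \<Longrightarrow> f z = h z + cnj (g z)"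
    using hg by (auto simp: canonical_parts_def)
  obtain h' g' where hg': "canonical_parts f h' g'"
      "\<And>z. z \<in> \<D> \<Longrightarrow> (cmod (deriv h' z))\<^sup>2 - (cmod (deriv g' z))\<^sup>2 > 0"
    using f(1) by (auto simp: sense_preserving_def)
  have "cmod (deriv g z) < cmod (deriv h z)" if z: "z \<in> \<D>" for z
  proof -
    have "deriv h z = deriv h' z" "deriv g z = deriv g' z"
      using hol hg' canonical_parts_unique[OF hg hg'(1)] z
      by (auto intro!: complex_derivative_transform_within_open[of _ \<D>] simp: canonical_parts_def)
    then show ?thesis using hg'(2)[OF z] power2_less_imp_less[of "cmod (deriv g z)" "cmod (deriv h z)"] by simp
  qed
  moreover have "deriv g 0 = 0"
    using dzbar_harmonic[OF hol(1,2) fz, of 0] f(3) by simp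
  ultimately have "shear_pair h g (exp (\<i> * of_real \<theta>))"
    using S hol by (simp add: shear_pair_def class_S_def)
  then show ?thesis using that fz f(2) by blast
qed

section \<open>Curvature along images of circles\<close>

lemma has_vector_derivative_circle:
  assumes F: "F holomorphic_on \<D>" and r: "0 \<le> r" "r < 1"
  shows "((\<lambda>t. F (of_real r * exp (\<i> * of_real t))) has_vector_derivative
           (\<i> * (of_real r * exp (\<i> * of_real t)) * deriv F (of_real r * exp (\<i> * of_real t)))) (at t)"
proof -
  have b: "of_real r * exp (\<i> * of_real t) \<in> \<D>" using r by (simp add: norm_mult)
  have "((\<lambda>w. of_real r * exp (\<i> * w)) has_field_derivative (\<i> * (of_real r * exp (\<i> * of_real t)))) (at (of_real t))"
    by (auto intro!: derivative_eq_intros)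
  from DERIV_chain2[OF holomorphic_derivI[OF F open_ball b] this]
  show ?thesis by (intro has_vector_derivative_real_field) (simp add: mult.commute)
qed

text \<open>The velocity of the image curve divided by \<open>\<i>\<close>. With this factor removed
  the acceleration is minus \<open>circle_tangent_deriv\<close>, and the imaginary part in the
  curvature becomes the real part of \<open>cnj A * B\<close> for the two quantities
  \<open>A\<close> and \<open>B\<close>.\<close>

definition circle_tangent where
  "circle_tangent h g z = z * deriv h z - cnj (z * deriv g z)"

definition circle_tangent_deriv where
  "circle_tangent_deriv h g z =
     z * (deriv h z + z * deriv (deriv h) z) + cnj (z * (deriv g z + z * deriv (deriv g) z))"

lemma has_vector_derivative_harmonic_circle:
  assumes h: "h holomorphic_on \<D>" and g: "g holomorphic_on \<D>" and r: "0 \<le> r" "r < 1"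
    and f: "\<And>z. z \<in> \<D> \<Longrightarrow> f z = h z + cnj (g z)"
  shows "((\<lambda>t. f (of_real r * exp (\<i> * of_real t))) has_vector_derivative
           (\<i> * circle_tangent h g (of_real r * exp (\<i> * of_real t)))) (at t)"
    and "((\<lambda>t. circle_tangent h g (of_real r * exp (\<i> * of_real t))) has_vector_derivative
           (\<i> * circle_tangent_deriv h g (of_real r * exp (\<i> * of_real t)))) (at t)"
proof -
  have b: "of_real r * exp (\<i> * of_real t) \<in> \<D>" for t using r by (simp add: norm_mult)
  have "(\<lambda>t. f (of_real r * exp (\<i> * of_real t)))
      = (\<lambda>t. h (of_real r * exp (\<i> * of_real t)) + cnj (g (of_real r * exp (\<i> * of_real t))))"
    using f b by auto
  then show "((\<lambda>t. f (of_real r * exp (\<i> * of_real t))) has_vector_derivative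
           (\<i> * circle_tangent h g (of_real r * exp (\<i> * of_real t)))) (at t)"
    using has_vector_derivative_add[OF has_vector_derivative_circle[OF h r]
      has_vector_derivative_cnj[OF has_vector_derivative_circle[OF g r]]]
    by (simp add: circle_tangent_def algebra_simps)
  have H: "(\<lambda>z. z * deriv F z) holomorphic_on \<D>" if "F holomorphic_on \<D>" for F
    by (intro holomorphic_intros holomorphic_deriv that) auto
  have dH: "deriv (\<lambda>z. z * deriv F z) z = deriv F z + z * deriv (deriv F) z"
    if F: "F holomorphic_on \<D>" and z: "z \<in> \<D>" for F z
  proof -
    have "(deriv F has_field_derivative deriv (deriv F) z) (at z)"
      by (rule holomorphic_derivI[OF holomorphic_deriv[OF F]]) (use z in auto)
    then show ?thesis
      by (intro DERIV_imp_deriv) (auto intro!: derivative_eq_intros)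
  qed
  show "((\<lambda>t. circle_tangent h g (of_real r * exp (\<i> * of_real t))) has_vector_derivative
           (\<i> * circle_tangent_deriv h g (of_real r * exp (\<i> * of_real t)))) (at t)"
    using has_vector_derivative_diff[OF has_vector_derivative_circle[OF H[OF h] r]
      has_vector_derivative_cnj[OF has_vector_derivative_circle[OF H[OF g] r]]]
    unfolding circle_tangent_def circle_tangent_deriv_def dH[OF h b] dH[OF g b]
    by (simp add: algebra_simps)
qed

lemma curvature_harmonic:
  assumes h: "h holomorphic_on \<D>" and g: "g holomorphic_on \<D>"
    and f: "\<And>z. z \<in> \<D> \<Longrightarrow> f z = h z + cnj (g z)" and z: "z \<in> \<D>"
  shows "curvature f z = Re (cnj (circle_tangent h g z) * circle_tangent_deriv h g z) / cmod (circle_tangent h g z) ^ 3"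
proof -
  define r where "r = cmod z"
  have r: "0 \<le> r" "r < 1" using z by (auto simp: r_def)
  have z': "of_real r * exp (\<i> * of_real (Arg z)) = z"
    using rcis_cmod_Arg[of z] by (simp add: r_def rcis_def cis_conv_exp)
  define \<gamma> where "\<gamma> = (\<lambda>t. f (of_real r * exp (\<i> * of_real t)))"
  note d = has_vector_derivative_harmonic_circle[OF h g r f]
  have 1: "(\<lambda>s. vector_derivative \<gamma> (at s)) = (\<lambda>s. \<i> * circle_tangent h g (of_real r * exp (\<i> * of_real s)))"
    unfolding \<gamma>_def by (rule ext, rule vector_derivative_at, rule d(1))
  have "((\<lambda>s. \<i> * circle_tangent h g (of_real r * exp (\<i> * of_real s))) has_vector_derivative
      (\<i> * (\<i> * circle_tangent_deriv h g (of_real r * exp (\<i> * of_real (Arg z)))))) (at (Arg z))"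
    by (intro has_vector_derivative_mult_right d(2))
  then have 2: "vector_derivative (\<lambda>s. \<i> * circle_tangent h g (of_real r * exp (\<i> * of_real s))) (at (Arg z))
      = \<i> * (\<i> * circle_tangent_deriv h g z)"
    unfolding z' by (rule vector_derivative_at)
  show ?thesis
    unfolding curvature_def signed_curvature_def r_def[symmetric] \<gamma>_def[symmetric] Let_def 1 2
    by (simp add: z' norm_mult)
qed

text \<open>
  Here \<open>x = z h'\<close>, \<open>x1 = z x'\<close>, \<open>w\<close> is the dilatation, \<open>u = z w'\<close> and
  \<open>p = 1 + z \<phi>'' / \<phi>'\<close> with \<open>\<phi> = h + l g\<close>. The number multiplying \<open>u\<close> besides \<open>x\<^sup>2\<close> is
  unimodular up to the factor \<open>|x|\<^sup>2\<close>, which is what makes the estimate sharp.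
\<close>

lemma curvature_numerator_estimate:
  fixes x x1 w u l p :: complex and B :: real
  assumes l: "cmod l = 1" and w: "cmod w < 1" and B: "cmod u \<le> B * (1 - (cmod w)\<^sup>2)"
    and eq: "x1 * (1 + l * w) + x * l * u = x * (1 + l * w) * p"
  defines "n \<equiv> Re (cnj (x - cnj (w * x)) * (x1 + cnj (u * x + w * x1)))"
  shows "\<bar>n - (cmod x)\<^sup>2 * (1 - (cmod w)\<^sup>2) * Re p\<bar> \<le> (cmod x)\<^sup>2 * (1 - (cmod w)\<^sup>2) * (2 * B)"
proof -
  define d where "d = 1 + l * w"
  define v where "v = l * cnj d / d"
  have lw: "cmod (l * w) < 1" using l w by (simp add: norm_mult)
  have d: "d \<noteq> 0"
  proof
    assume "d = 0"
    then have "l * w = - 1" by (simp add: d_def eq_neg_iff_add_eq_0 add.commute)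
    then show False using lw by simp
  qed
  have v: "cmod v = 1" using d l by (simp add: v_def norm_mult norm_divide)
  have w2: "complex_of_real ((cmod w)\<^sup>2) = w * cnj w" and x2: "complex_of_real ((cmod x)\<^sup>2) = x * cnj x"
    and l2: "l * cnj l = 1"
    using complex_norm_square[of w] complex_norm_square[of x] complex_norm_square[of l] l by simp_all
  have x1: "x1 = x * p - x * l * u / d"
    using eq d unfolding d_def[symmetric] by (simp add: field_simps)
  \<comment> \<open>This is the coefficient that appears once \<open>x1\<close> has been eliminated.
    After clearing the denominator the terms in |w|^2 cancel, and \<open>l * cnj l = 1\<close> makes
    the rest equal to \<open>l * cnj d\<close>, a number of the same modulus as
    \<open>d\<close>.\<close>
  have vd: "cnj w + (1 - w * cnj w) * l / d = v"
  proof -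
    have "cnj w * d + (1 - w * cnj w) * l = l * cnj d"
      using l2 by (simp add: d_def algebra_simps)
    then show ?thesis using d by (simp add: v_def field_simps)
  qed
  have "n = Re (cnj x * x1) - Re (cnj (w * x) * (u * x + w * x1)) + Re (x * (u * x + w * x1) - w * x * x1)"
    unfolding n_def by (simp add: algebra_simps)
  also have "\<dots> = Re ((1 - w * cnj w) * (cnj x * x1) - x * cnj x * cnj w * u + x\<^sup>2 * u)"
    by (simp add: power2_eq_square algebra_simps)
  also have "(1 - w * cnj w) * (cnj x * x1) - x * cnj x * cnj w * u + x\<^sup>2 * u
      = (x * cnj x) * (1 - w * cnj w) * p + u * (x\<^sup>2 - x * cnj x * (cnj w + (1 - w * cnj w) * l / d))"
    unfolding x1 by (simp add: algebra_simps diff_divide_distrib)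
  also have "\<dots> = of_real ((cmod x)\<^sup>2 * (1 - (cmod w)\<^sup>2)) * p + u * (x\<^sup>2 - of_real ((cmod x)\<^sup>2) * v)"
    unfolding vd of_real_mult of_real_diff w2 x2 by simp
  finally have "n - (cmod x)\<^sup>2 * (1 - (cmod w)\<^sup>2) * Re p = Re (u * (x\<^sup>2 - of_real ((cmod x)\<^sup>2) * v))"
    by (simp only: plus_complex.sel Re_complex_of_real times_complex.sel Im_complex_of_real mult_zero_left diff_zero)
  also have "\<bar>\<dots>\<bar> \<le> cmod u * cmod (x\<^sup>2 - of_real ((cmod x)\<^sup>2) * v)"
    using abs_Re_le_cmod by (metis norm_mult)
  also have "\<dots> \<le> (B * (1 - (cmod w)\<^sup>2)) * (2 * (cmod x)\<^sup>2)"
  proof (intro mult_mono B)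
    show "cmod (x\<^sup>2 - of_real ((cmod x)\<^sup>2) * v) \<le> 2 * (cmod x)\<^sup>2"
      using norm_triangle_ineq4[of "x\<^sup>2" "of_real ((cmod x)\<^sup>2) * v"] v by (simp add: norm_mult norm_power)
    show "0 \<le> B * (1 - (cmod w)\<^sup>2)" using B norm_ge_zero order_trans by blast
  qed simp
  finally show ?thesis by (simp add: algebra_simps)
qed

text \<open>Reduces the geometry to three real numbers: \<open>x\<close> is the modulus of
  \<open>z * deriv h z\<close>, \<open>w\<close> that of the dilatation, \<open>q\<close> the
  normalised numerator. Distortion is known for the shear only, whose derivative is that of
  \<open>h\<close> times 1 + l \<omega>; the modulus of this factor lies between 1 - w and 1 + w,
  hence the mixed bounds on \<open>x * (1 + w)\<close> and \<open>x * (1 - w)\<close>.\<close>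

lemma shear_pair_estimates:
  assumes sp: "shear_pair h g l" and r: "cmod z = r" "0 < r" "r < 1"
  obtains x w q where "0 < x" "0 \<le> w" "w \<le> r"
    "r * ((1 - r) / (1 + r)^3) \<le> x * (1 + w)" "x * (1 - w) \<le> r * ((1 + r) / (1 - r)^3)"
    "x * (1 - w) \<le> cmod (circle_tangent h g z)" "cmod (circle_tangent h g z) \<le> x * (1 + w)"
    "Re (cnj (circle_tangent h g z) * circle_tangent_deriv h g z) = x\<^sup>2 * (1 - w\<^sup>2) * q"
    "(1 - 6*r + r\<^sup>2) / (1 - r\<^sup>2) \<le> q" "q \<le> (1 + 6*r + r\<^sup>2) / (1 - r\<^sup>2)"
proof -
  have h: "h holomorphic_on \<D>" and g: "g holomorphic_on \<D>" and n: "deriv h 0 = 1" "deriv g 0 = 0" and l: "cmod l = 1"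
    and lt: "\<And>z. z \<in> \<D> \<Longrightarrow> cmod (deriv g z) < cmod (deriv h z)"
    and inj: "inj_on (\<lambda>z. h z + l * g z) \<D>"
    using sp by (auto simp: shear_pair_def)
  have zD: "z \<in> \<D>" using r by simp
  have hnz: "deriv h z \<noteq> 0" if "z \<in> \<D>" for z using lt[OF that] by auto
  have h': "deriv h holomorphic_on \<D>" and g': "deriv g holomorphic_on \<D>"
    using h g by (auto intro!: holomorphic_deriv)
  define \<omega> where "\<omega> = (\<lambda>z. deriv g z / deriv h z)"
  have \<omega>h: "\<omega> holomorphic_on \<D>" unfolding \<omega>_def using hnz by (intro holomorphic_intros h' g') auto
  have \<omega>1: "cmod (\<omega> z) < 1" if "cmod z < 1" for z
    using lt[of z] hnz[of z] that by (simp add: \<omega>_def norm_divide)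
  have \<omega>z: "cmod (\<omega> z) \<le> r"
    using Schwarz_Lemma(1)[OF \<omega>h _ \<omega>1, of z] r n by (simp add: \<omega>_def)
  have gh: "deriv g z = \<omega> z * deriv h z" if "z \<in> \<D>" for z using hnz[OF that] by (simp add: \<omega>_def)
  define \<phi> where "\<phi> = (\<lambda>z. h z + l * g z)"
  have \<phi>h: "\<phi> holomorphic_on \<D>" unfolding \<phi>_def by (intro holomorphic_intros h g)
  have \<phi>inj: "inj_on \<phi> \<D>" using inj by (simp add: \<phi>_def)
  have d\<phi>: "deriv \<phi> z = deriv h z * (1 + l * \<omega> z)" if z: "z \<in> \<D>" for z
  proof -
    have "(\<phi> has_field_derivative (deriv h z + l * deriv g z)) (at z)"
      unfolding \<phi>_def using holomorphic_derivI[OF h open_ball z] holomorphic_derivI[OF g open_ball z]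
      by (intro DERIV_add DERIV_cmult)
    then show ?thesis using gh[OF z] by (simp add: DERIV_imp_deriv algebra_simps)
  qed
  have \<phi>0: "deriv \<phi> 0 = 1" using d\<phi>[of 0] n by (simp add: \<omega>_def)
  have dh': "(deriv h has_field_derivative deriv (deriv h) z) (at z)"
    and d\<omega>: "(\<omega> has_field_derivative deriv \<omega> z) (at z)"
    using zD by (auto intro!: holomorphic_derivI[OF h'] holomorphic_derivI[OF \<omega>h])
  have dd\<phi>: "deriv (deriv \<phi>) z = deriv (deriv h) z * (1 + l * \<omega> z) + deriv h z * (l * deriv \<omega> z)"
  proof -
    have "((\<lambda>z. deriv h z * (1 + l * \<omega> z)) has_field_derivative
        (deriv (deriv h) z * (1 + l * \<omega> z) + deriv h z * (l * deriv \<omega> z))) (at z)"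
      by (auto intro!: derivative_eq_intros dh' d\<omega>)
    then have "(deriv \<phi> has_field_derivative
        (deriv (deriv h) z * (1 + l * \<omega> z) + deriv h z * (l * deriv \<omega> z))) (at z)"
      by (rule has_field_derivative_transform_within_open[of _ _ _ \<D>]) (use d\<phi> zD in auto)
    then show ?thesis by (rule DERIV_imp_deriv)
  qed
  have ddg: "deriv (deriv g) z = deriv \<omega> z * deriv h z + \<omega> z * deriv (deriv h) z"
  proof -
    have "((\<lambda>z. \<omega> z * deriv h z) has_field_derivative
        (deriv \<omega> z * deriv h z + \<omega> z * deriv (deriv h) z)) (at z)"
      by (auto intro!: derivative_eq_intros dh' d\<omega>)
    then have "(deriv g has_field_derivative (deriv \<omega> z * deriv h z + \<omega> z * deriv (deriv h) z)) (at z)"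
      by (rule has_field_derivative_transform_within_open[of _ _ _ \<D>]) (use gh zD in auto)
    then show ?thesis by (rule DERIV_imp_deriv)
  qed
  have \<phi>nz: "deriv \<phi> z \<noteq> 0"
    by (rule holomorphic_injective_imp_regular[OF \<phi>h _ \<phi>inj]) (use zD in auto)
  define x where "x = z * deriv h z"
  define x1 where "x1 = z * (deriv h z + z * deriv (deriv h) z)"
  define w where "w = \<omega> z"
  define u where "u = z * deriv \<omega> z"
  define p where "p = 1 + z * deriv (deriv \<phi>) z / deriv \<phi> z"
  define N where "N = Re (cnj (circle_tangent h g z) * circle_tangent_deriv h g z)"
  have ct: "circle_tangent h g z = x - cnj (w * x)"
    using gh[OF zD] by (simp add: circle_tangent_def x_def w_def algebra_simps)
  have ctd: "circle_tangent_deriv h g z = x1 + cnj (u * x + w * x1)"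
    unfolding circle_tangent_deriv_def ddg gh[OF zD] by (simp add: x_def x1_def w_def u_def algebra_simps)
  have eq: "x1 * (1 + l * w) + x * l * u = x * (1 + l * w) * p"
  proof -
    have "x * (1 + l * w) = z * deriv \<phi> z" by (simp add: x_def w_def d\<phi>[OF zD])
    then have "x * (1 + l * w) * p = z * deriv \<phi> z + z * z * deriv (deriv \<phi>) z"
      using \<phi>nz by (simp add: p_def distrib_left)
    then show ?thesis
      unfolding dd\<phi> d\<phi>[OF zD] by (simp add: x_def x1_def w_def u_def algebra_simps)
  qed
  have r2: "1 - r\<^sup>2 > 0" using r by (simp add: abs_square_less_1)
  have w1: "cmod w < 1" using \<omega>1 r by (simp add: w_def)
  have uB: "cmod u \<le> (r / (1 - r\<^sup>2)) * (1 - (cmod w)\<^sup>2)"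
  proof -
    have "cmod (deriv \<omega> z) * (1 - r\<^sup>2) \<le> 1 - (cmod w)\<^sup>2"
      using schwarz_pick_derivative[OF \<omega>h \<omega>1, of z] r by (simp add: w_def)
    then have "cmod (deriv \<omega> z) \<le> (1 - (cmod w)\<^sup>2) / (1 - r\<^sup>2)" using r2 by (simp add: pos_le_divide_eq)
    then have "r * cmod (deriv \<omega> z) \<le> r * ((1 - (cmod w)\<^sup>2) / (1 - r\<^sup>2))"
      using r by (intro mult_left_mono) auto
    then show ?thesis by (simp add: u_def norm_mult r)
  qed
  define m where "m = (cmod x)\<^sup>2 * (1 - (cmod w)\<^sup>2)"
  have x0: "cmod x > 0" using hnz[OF zD] r by (auto simp: x_def)
  have m: "m > 0" using x0 w1 by (simp add: m_def abs_square_less_1)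
  have Nm: "\<bar>N - m * Re p\<bar> \<le> m * (2 * (r / (1 - r\<^sup>2)))"
    using curvature_numerator_estimate[OF l w1 uB eq] unfolding N_def ct ctd m_def .
  define q where "q = N / m"
  have Nq: "N = m * q" using m by (simp add: q_def)
  have "m * \<bar>q - Re p\<bar> \<le> m * (2 * (r / (1 - r\<^sup>2)))"
    using Nm m unfolding Nq by (simp flip: right_diff_distrib add: abs_mult)
  then have qp: "\<bar>q - Re p\<bar> \<le> 2 * (r / (1 - r\<^sup>2))" using m by (rule mult_left_le_imp_le)
  have Rp: "Re p = 1 + Re (z * deriv (deriv \<phi>) z / deriv \<phi> z)" by (simp add: p_def)
  have "1 + (2*r\<^sup>2 - 4*r) / (1 - r\<^sup>2) \<le> Re p" "Re p \<le> 1 + (2*r\<^sup>2 + 4*r) / (1 - r\<^sup>2)"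
    unfolding Rp using koebe_pre_schwarzian[OF \<phi>h \<phi>inj r(1,3)] by auto
  moreover have frac: "1 + y / s - 2 * (r / s) = (s + y - 2 * r) / s" "1 + y / s + 2 * (r / s) = (s + y + 2 * r) / s"
    if "s \<noteq> 0" for s y :: real
    using that by (simp_all add: field_simps)
  have "1 + (2*r\<^sup>2 - 4*r) / (1 - r\<^sup>2) - 2 * (r / (1 - r\<^sup>2)) = (1 - 6*r + r\<^sup>2) / (1 - r\<^sup>2)"
    "1 + (2*r\<^sup>2 + 4*r) / (1 - r\<^sup>2) + 2 * (r / (1 - r\<^sup>2)) = (1 + 6*r + r\<^sup>2) / (1 - r\<^sup>2)"
    using r2 by (subst frac, simp, simp add: algebra_simps)+
  ultimately have q: "(1 - 6*r + r\<^sup>2) / (1 - r\<^sup>2) \<le> q" "q \<le> (1 + 6*r + r\<^sup>2) / (1 - r\<^sup>2)"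
    using qp by linarith+
  have wx: "cmod (cnj (w * x)) = cmod x * cmod w" by (simp only: complex_mod_cnj norm_mult mult.commute)
  have A: "cmod x * (1 - cmod w) \<le> cmod (circle_tangent h g z)" "cmod (circle_tangent h g z) \<le> cmod x * (1 + cmod w)"
    unfolding ct using norm_triangle_ineq2[of x "cnj (w * x)"] norm_triangle_ineq4[of x "cnj (w * x)"]
    unfolding wx by (simp_all add: algebra_simps)
  have X: "r * cmod (deriv \<phi> z) = cmod x * cmod (1 + l * w)"
    by (simp add: d\<phi>[OF zD] x_def w_def norm_mult r)
  have lw: "1 - cmod w \<le> cmod (1 + l * w)" "cmod (1 + l * w) \<le> 1 + cmod w"
    using norm_triangle_ineq2[of 1 "- (l * w)"] norm_triangle_ineq[of 1 "l * w"] l by (auto simp: norm_mult)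
  have "r * ((1 - r) / (1 + r)^3) \<le> r * cmod (deriv \<phi> z)" "r * cmod (deriv \<phi> z) \<le> r * ((1 + r) / (1 - r)^3)"
    using koebe_distortion[OF \<phi>h \<phi>inj \<phi>0 r(1,3)] r(2) by (simp_all only: mult_left_mono less_imp_le)
  moreover have "cmod x * (1 - cmod w) \<le> cmod x * cmod (1 + l * w)" "cmod x * cmod (1 + l * w) \<le> cmod x * (1 + cmod w)"
    using lw by (auto intro!: mult_left_mono)
  ultimately have "r * ((1 - r) / (1 + r)^3) \<le> cmod x * (1 + cmod w)" "cmod x * (1 - cmod w) \<le> r * ((1 + r) / (1 - r)^3)"
    unfolding X by linarith+
  then show ?thesis
    using that[of "cmod x" "cmod w" q] x0 \<omega>z A Nq q by (simp add: N_def m_def w_def)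
qed

text \<open>The affine image is again harmonic, with parts h + c g and g + cnj c h. The tangent
  acquires a minus sign, \<open>A - c * cnj A\<close>, since the factor \<open>\<i>\<close> taken
  out of the velocity is conjugated too. The factor 1 - |c|^2 is the determinant of the affine
  map.\<close>

lemma curvature_affine_harmonic:
  assumes h: "h holomorphic_on \<D>" and g: "g holomorphic_on \<D>" and z: "z \<in> \<D>"
    and f: "\<And>z. z \<in> \<D> \<Longrightarrow> f z = (h z + cnj (g z)) + c * cnj (h z + cnj (g z))"
  shows "curvature f z = (1 - (cmod c)\<^sup>2) * Re (cnj (circle_tangent h g z) * circle_tangent_deriv h g z)
           / cmod (circle_tangent h g z - c * cnj (circle_tangent h g z)) ^ 3"
proof -
  define H where "H = (\<lambda>z. h z + c * g z)"
  define G where "G = (\<lambda>z. g z + cnj c * h z)"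
  have HG: "H holomorphic_on \<D>" "G holomorphic_on \<D>"
    unfolding H_def G_def by (intro holomorphic_intros h g)+
  have lin: "deriv (\<lambda>w. F w + a * E w) w = deriv F w + a * deriv E w"
    if "F holomorphic_on \<D>" "E holomorphic_on \<D>" "w \<in> \<D>" for F E a w
    using that holomorphic_derivI[OF that(1) open_ball that(3)] holomorphic_derivI[OF that(2) open_ball that(3)]
    by (intro DERIV_imp_deriv DERIV_add DERIV_cmult)
  have lin2: "deriv (deriv (\<lambda>w. F w + a * E w)) z = deriv (deriv F) z + a * deriv (deriv E) z"
    if F: "F holomorphic_on \<D>" "E holomorphic_on \<D>" for F E a
  proof -
    have D: "deriv F holomorphic_on \<D>" "deriv E holomorphic_on \<D>" using F by (auto intro!: holomorphic_deriv)
    have "deriv (deriv (\<lambda>w. F w + a * E w)) z = deriv (\<lambda>w. deriv F w + a * deriv E w) z"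
      by (rule complex_derivative_transform_within_open[of _ \<D>])
        (use lin[OF F] z in \<open>auto intro!: holomorphic_intros holomorphic_deriv F D\<close>)
    then show ?thesis using lin[OF D z] by simp
  qed
  have ct: "circle_tangent H G z = circle_tangent h g z - c * cnj (circle_tangent h g z)"
    unfolding circle_tangent_def H_def G_def lin[OF h g z] lin[OF g h z] by (simp add: algebra_simps)
  have ctd: "circle_tangent_deriv H G z = circle_tangent_deriv h g z + c * cnj (circle_tangent_deriv h g z)"
    unfolding circle_tangent_deriv_def H_def G_def lin[OF h g z] lin[OF g h z] lin2[OF h g] lin2[OF g h]
    by (simp add: algebra_simps)
  have "Re (cnj (A - c * cnj A) * (B + c * cnj B)) = (1 - (cmod c)\<^sup>2) * Re (cnj A * B)" for A B
    unfolding cmod_power2 by (simp add: power2_eq_square algebra_simps)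
  moreover have "curvature f z = Re (cnj (circle_tangent H G z) * circle_tangent_deriv H G z) / cmod (circle_tangent H G z) ^ 3"
    by (rule curvature_harmonic[OF HG _ z]) (simp add: f H_def G_def algebra_simps)
  ultimately show ?thesis unfolding ct ctd by simp
qed

text \<open>The curvature is \<open>E * q\<close> with \<open>E\<close> positive and enclosed
  between \<open>El\<close> and \<open>Eu\<close>. Which end of this range is the worst case for the
  lower bound depends on the sign of the bound for \<open>q\<close>.\<close>

lemma curvature_shear_pair_bounds:
  assumes sp: "shear_pair h g l" and c: "cmod c < 1"
    and f: "\<And>z. z \<in> \<D> \<Longrightarrow> f z = (h z + cnj (g z)) + c * cnj (h z + cnj (g z))"
    and r: "cmod z = r" "0 < r" "r < 1"
  shows "curvature f z \<le> (1 + cmod c) / (1 - cmod c)\<^sup>2 * ((1 + r) / (1 - r)) ^ 4 * ((r\<^sup>2 + 6*r + 1) / r)" (is ?U)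
    and "0 \<le> r\<^sup>2 - 6*r + 1 \<Longrightarrow>
      (1 - cmod c) / (1 + cmod c)\<^sup>2 * ((1 - r) / (1 + r)) ^ 4 * ((r\<^sup>2 - 6*r + 1) / r) \<le> curvature f z" (is "_ \<Longrightarrow> ?L")
    and "r\<^sup>2 - 6*r + 1 \<le> 0 \<Longrightarrow>
      (1 + cmod c) / (1 - cmod c)\<^sup>2 * ((1 + r) / (1 - r)) ^ 4 * ((r\<^sup>2 - 6*r + 1) / r) \<le> curvature f z" (is "_ \<Longrightarrow> ?M")
proof -
  obtain x w q where e: "0 < x" "0 \<le> w" "w \<le> r"
    "r * ((1 - r) / (1 + r)^3) \<le> x * (1 + w)" "x * (1 - w) \<le> r * ((1 + r) / (1 - r)^3)"
    "x * (1 - w) \<le> cmod (circle_tangent h g z)" "cmod (circle_tangent h g z) \<le> x * (1 + w)"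
    "Re (cnj (circle_tangent h g z) * circle_tangent_deriv h g z) = x\<^sup>2 * (1 - w\<^sup>2) * q"
    "(1 - 6*r + r\<^sup>2) / (1 - r\<^sup>2) \<le> q" "q \<le> (1 + 6*r + r\<^sup>2) / (1 - r\<^sup>2)"
    by (rule shear_pair_estimates[OF sp r]) blast
  define C where "C = cmod c"
  have C: "0 \<le> C" "C < 1" using c by (simp_all add: C_def)
  define A where "A = circle_tangent h g z"
  define a where "a = cmod (A - c * cnj A)"
  have "cmod (c * cnj A) = C * cmod A" by (simp add: norm_mult C_def)
  then have "cmod A * (1 - C) \<le> a" "a \<le> cmod A * (1 + C)"
    unfolding a_def using norm_triangle_ineq2[of A "c * cnj A"] norm_triangle_ineq4[of A "c * cnj A"]
    by (simp_all add: algebra_simps)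
  moreover have "x * (1 - w) * (1 - C) \<le> cmod A * (1 - C)" "cmod A * (1 + C) \<le> x * (1 + w) * (1 + C)"
    using e C unfolding A_def by (auto intro!: mult_right_mono)
  ultimately have a: "x * (1 - w) * (1 - C) \<le> a" "a \<le> x * (1 + w) * (1 + C)" by linarith+
  have w1: "w < 1" using e r by simp
  have apos: "0 < x * (1 - w) * (1 - C)" using e C w1 by simp
  define E where "E = (1 - C\<^sup>2) * (x\<^sup>2 * (1 - w\<^sup>2)) / a ^ 3"
  have a0: "0 < a" using apos a(1) by linarith
  have num: "0 < (1 - C\<^sup>2) * (x\<^sup>2 * (1 - w\<^sup>2))"
    using C e w1 by (simp add: abs_square_less_1)
  have k: "curvature f z = E * q"
    using curvature_affine_harmonic[of h g z f c] sp f r e(8)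
    by (simp add: shear_pair_def E_def a_def A_def C_def)
  have f1: "(1 - C\<^sup>2) * (x\<^sup>2 * (1 - w\<^sup>2)) = (1 + C) * (1 - C) * (x\<^sup>2 * ((1 + w) * (1 - w)))"
    by (simp add: power2_eq_square algebra_simps)
  define Eu where "Eu = (1 + C) / (1 - C)\<^sup>2 * ((1 + r)^5 / (r * (1 - r)^3))"
  define El where "El = (1 - C) / (1 + C)\<^sup>2 * ((1 - r)^5 / (r * (1 + r)^3))"
  have Eu: "E \<le> Eu"
  proof -
    have "E \<le> (1 - C\<^sup>2) * (x\<^sup>2 * (1 - w\<^sup>2)) / (x * (1 - w) * (1 - C)) ^ 3"
      unfolding E_def using num apos a a0 e(1,2) w1 C by (intro divide_left_mono power_mono mult_pos_pos zero_less_power) auto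
    \<comment> \<open>Arranged so that \<open>x\<close> occurs only in \<open>x * (1 + w)\<close>,
      the product that distortion bounds from below; what remains is increasing in \<open>w\<close>
      and is estimated by \<open>w \<le> r\<close>.\<close>
    also have "\<dots> = (1 + C) / (1 - C)\<^sup>2 * (((1 + w) / (1 - w))\<^sup>2 / (x * (1 + w)))"
      unfolding f1 using e w1 C by (simp add: power_mult_distrib divide_simps) (simp add: eval_nat_numeral algebra_simps)
    also have "\<dots> \<le> (1 + C) / (1 - C)\<^sup>2 * (((1 + r) / (1 - r))\<^sup>2 / (r * ((1 - r) / (1 + r)^3)))"
      using e w1 C r by (intro mult_left_mono frac_le power_mono) (auto intro!: frac_le)
    also have "\<dots> = Eu"
      unfolding Eu_def using r by (simp add: divide_simps) (simp add: eval_nat_numeral algebra_simps)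
    finally show ?thesis .
  qed
  have El: "El \<le> E"
  proof -
    have "El = (1 - C) / (1 + C)\<^sup>2 * (((1 - r) / (1 + r))\<^sup>2 / (r * ((1 + r) / (1 - r)^3)))"
      unfolding El_def using r by (simp add: divide_simps) (simp add: eval_nat_numeral algebra_simps)
    also have "\<dots> \<le> (1 - C) / (1 + C)\<^sup>2 * (((1 - w) / (1 + w))\<^sup>2 / (x * (1 - w)))"
      using e w1 C r by (intro mult_left_mono frac_le power_mono) (auto intro!: frac_le)
    also have "\<dots> = (1 - C\<^sup>2) * (x\<^sup>2 * (1 - w\<^sup>2)) / (x * (1 + w) * (1 + C)) ^ 3"
      unfolding f1 using e w1 C by (simp add: power_mult_distrib divide_simps) (simp add: eval_nat_numeral algebra_simps)
    also have "\<dots> \<le> E"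
      unfolding E_def using num apos a a0 e(1,2) w1 C by (intro divide_left_mono power_mono mult_pos_pos zero_less_power) auto
    finally show ?thesis .
  qed
  have El0: "0 \<le> El" using C r by (simp add: El_def)
  have r2: "0 < 1 - r\<^sup>2" using r by (simp add: abs_square_less_1)
  have pu: "Eu * (y / (1 - r\<^sup>2)) = (1 + C) / (1 - C)\<^sup>2 * ((1 + r) / (1 - r)) ^ 4 * (y / r)" for y
  proof -
    have "1 - r\<^sup>2 = (1 - r) * (1 + r)" by (simp add: power2_eq_square algebra_simps)
    then show ?thesis
      unfolding Eu_def using r by (simp add: divide_simps) (simp add: eval_nat_numeral)
  qed
  have pl: "El * (y / (1 - r\<^sup>2)) = (1 - C) / (1 + C)\<^sup>2 * ((1 - r) / (1 + r)) ^ 4 * (y / r)" for y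
  proof -
    have "1 - r\<^sup>2 = (1 - r) * (1 + r)" by (simp add: power2_eq_square algebra_simps)
    then show ?thesis
      unfolding El_def using r by (simp add: divide_simps) (simp add: eval_nat_numeral)
  qed
  have q: "(r\<^sup>2 - 6*r + 1) / (1 - r\<^sup>2) \<le> q" "q \<le> (r\<^sup>2 + 6*r + 1) / (1 - r\<^sup>2)"
    using e by (simp_all add: algebra_simps)
  have "E * q \<le> E * ((r\<^sup>2 + 6*r + 1) / (1 - r\<^sup>2))" using q El El0 by (intro mult_left_mono) auto
  also have "\<dots> \<le> Eu * ((r\<^sup>2 + 6*r + 1) / (1 - r\<^sup>2))" using Eu r r2 by (intro mult_right_mono) auto
  finally show ?U unfolding k pu C_def .
  have *: "E * ((r\<^sup>2 - 6*r + 1) / (1 - r\<^sup>2)) \<le> E * q" using q El El0 by (intro mult_left_mono) auto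
  show ?L if "0 \<le> r\<^sup>2 - 6*r + 1"
  proof -
    have "El * ((r\<^sup>2 - 6*r + 1) / (1 - r\<^sup>2)) \<le> E * ((r\<^sup>2 - 6*r + 1) / (1 - r\<^sup>2))"
      using El r2 that by (intro mult_right_mono) auto
    then show ?thesis using * unfolding k pl C_def by linarith
  qed
  show ?M if "r\<^sup>2 - 6*r + 1 \<le> 0"
  proof -
    have "Eu * ((r\<^sup>2 - 6*r + 1) / (1 - r\<^sup>2)) \<le> E * ((r\<^sup>2 - 6*r + 1) / (1 - r\<^sup>2))"
      using Eu r2 that by (intro mult_right_mono_neg) (auto simp: divide_nonpos_pos)
    then show ?thesis using * unfolding k pu C_def by linarith
  qed
qed

section \<open>Convexity\<close>

lemma radius_polynomial_factor:
  "r\<^sup>2 - 6*r + (1::real) = (3 - 2 * sqrt 2 - r) * (3 + 2 * sqrt 2 - r)"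
  by (simp add: power2_eq_square algebra_simps)

lemma radius_polynomial_pos:
  assumes "r < 3 - 2 * sqrt 2"
  shows "0 < r\<^sup>2 - 6*r + (1::real)"
proof -
  have "0 \<le> sqrt 2" by simp
  then have "0 < 3 - 2 * sqrt 2 - r" "0 < 3 + 2 * sqrt 2 - r" using assms by linarith+
  then show ?thesis unfolding radius_polynomial_factor by (rule mult_pos_pos)
qed

lemma shear_pair_curvature_pos:
  assumes sp: "shear_pair h g l" and z: "0 < cmod z" "cmod z < 3 - 2 * sqrt 2"
  shows "0 < Re (cnj (circle_tangent h g z) * circle_tangent_deriv h g z)"
proof -
  have "sqrt 2 > 1" by simp
  then have z1: "cmod z < 1" using z by linarith
  obtain x w q where e: "0 < x" "0 \<le> w" "w \<le> cmod z"
    "Re (cnj (circle_tangent h g z) * circle_tangent_deriv h g z) = x\<^sup>2 * (1 - w\<^sup>2) * q"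
    "(1 - 6*cmod z + (cmod z)\<^sup>2) / (1 - (cmod z)\<^sup>2) \<le> q"
    by (rule shear_pair_estimates[OF sp refl z(1) z1]) blast
  have "0 < (1 - 6*cmod z + (cmod z)\<^sup>2) / (1 - (cmod z)\<^sup>2)"
    using radius_polynomial_pos[OF z(2)] z1 by (intro divide_pos_pos) (auto simp: abs_square_less_1)
  then have "0 < q" using e by linarith
  moreover have "0 < 1 - w\<^sup>2" using e z1 by (simp add: abs_square_less_1)
  ultimately show ?thesis using e by simp
qed

text \<open>The tangent is \<open>\<zeta> * deriv h \<zeta>\<close> times a factor \<open>D\<close>
  of positive real part, because |g'| < |h'|. Hence \<open>D\<close> has a principal logarithm and
  \<open>deriv h\<close> a holomorphic one; only the logarithm of \<zeta> itself gains 2 \<pi>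
  \<open>\<i>\<close> in one turn.\<close>

lemma shear_pair_tangent_angle:
  assumes sp: "shear_pair h g l" and r: "0 < r" "r < 1"
  defines "\<zeta> \<equiv> \<lambda>t::real. complex_of_real r * exp (\<i> * of_real t)"
  obtains \<tau> :: "real \<Rightarrow> real" where
    "\<And>t. circle_tangent h g (\<zeta> t) \<noteq> 0"
    "\<And>t. circle_tangent h g (\<zeta> t) = of_real (cmod (circle_tangent h g (\<zeta> t))) * cis (\<tau> t)"
    "\<And>t. (\<tau> has_real_derivative
        Re (cnj (circle_tangent h g (\<zeta> t)) * circle_tangent_deriv h g (\<zeta> t)) / (cmod (circle_tangent h g (\<zeta> t)))\<^sup>2) (at t)"
    "\<And>t. \<tau> (t + 2*pi) = \<tau> t + 2*pi"
proof -
  have h: "h holomorphic_on \<D>" and g: "g holomorphic_on \<D>"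
    and lt: "\<And>z. z \<in> \<D> \<Longrightarrow> cmod (deriv g z) < cmod (deriv h z)"
    using sp by (auto simp: shear_pair_def)
  have h': "deriv h holomorphic_on \<D>" and g': "deriv g holomorphic_on \<D>"
    using h g by (auto intro!: holomorphic_deriv)
  have hnz: "deriv h z \<noteq> 0" if "z \<in> \<D>" for z using lt[OF that] by auto
  obtain L where L: "L holomorphic_on \<D>" "\<And>z. z \<in> \<D> \<Longrightarrow> exp (L z) = deriv h z"
    by (rule holomorphic_logarithm_exists[OF convex_ball open_ball h' hnz, of 0]) auto
  have \<zeta>D: "\<zeta> t \<in> \<D>" and \<zeta>0: "\<zeta> t \<noteq> 0" for t using r by (auto simp: \<zeta>_def norm_mult)
  define D where "D = (\<lambda>t. 1 - cnj (\<zeta> t * deriv g (\<zeta> t)) / (\<zeta> t * deriv h (\<zeta> t)))"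
  define A where "A = (\<lambda>t. circle_tangent h g (\<zeta> t))"
  define B where "B = (\<lambda>t. circle_tangent_deriv h g (\<zeta> t))"
  have AD: "A t = \<zeta> t * deriv h (\<zeta> t) * D t" for t
    using hnz[OF \<zeta>D] \<zeta>0 by (simp add: A_def D_def circle_tangent_def algebra_simps)
  have Dre: "0 < Re (D t)" for t
  proof -
    have "cmod (cnj (\<zeta> t * deriv g (\<zeta> t)) / (\<zeta> t * deriv h (\<zeta> t))) = cmod (deriv g (\<zeta> t)) / cmod (deriv h (\<zeta> t))"
      using \<zeta>0[of t] by (simp add: norm_divide norm_mult)
    also have "\<dots> < 1" using lt[OF \<zeta>D, of t] hnz[OF \<zeta>D, of t] by simp
    finally have "Re (cnj (\<zeta> t * deriv g (\<zeta> t)) / (\<zeta> t * deriv h (\<zeta> t))) < 1"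
      using complex_Re_le_cmod order_le_less_trans by blast
    then show ?thesis unfolding D_def minus_complex.sel by simp
  qed
  define \<Lambda> where "\<Lambda> = (\<lambda>t. of_real (ln r) + \<i> * of_real t + L (\<zeta> t) + Ln (D t))"
  have exp\<Lambda>: "exp (\<Lambda> t) = A t" for t
  proof -
    have "D t \<noteq> 0" using Dre[of t] by auto
    then show ?thesis
      using r L(2)[OF \<zeta>D, of t]
      by (simp add: \<Lambda>_def AD exp_add \<zeta>_def exp_of_real)
  qed
  have Anz: "A t \<noteq> 0" for t using exp\<Lambda>[of t] by (metis exp_not_eq_zero)
  have dA: "(A has_vector_derivative \<i> * B t) (at t)" for t
    unfolding A_def B_def \<zeta>_def using has_vector_derivative_harmonic_circle(2)[OF h g, of r] r by simp
  have d\<Lambda>: "(\<Lambda> has_vector_derivative (\<i> * B t / A t)) (at t)" for t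
  proof -
    have hol: "(\<lambda>z. z * deriv h z) holomorphic_on \<D>" "(\<lambda>z. z * deriv g z) holomorphic_on \<D>"
      by (intro holomorphic_intros h' g')+
    have circ: "\<exists>d. ((\<lambda>t. F (\<zeta> t)) has_vector_derivative d) (at t)" if "F holomorphic_on \<D>" for F
      unfolding \<zeta>_def using has_vector_derivative_circle[OF that, of r] r by auto
    obtain d1 where d1: "((\<lambda>t. L (\<zeta> t)) has_vector_derivative d1) (at t)" using circ[OF L(1)] by blast
    obtain d2 where d2: "((\<lambda>t. \<zeta> t * deriv h (\<zeta> t)) has_vector_derivative d2) (at t)" using circ[OF hol(1)] by blast
    obtain d3 where d3: "((\<lambda>t. \<zeta> t * deriv g (\<zeta> t)) has_vector_derivative d3) (at t)" using circ[OF hol(2)] by blast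
    have "D differentiable (at t)"
      unfolding D_def using \<zeta>0 hnz[OF \<zeta>D]
      by (intro differentiable_diff differentiable_const differentiable_divide)
        (use d2 has_vector_derivative_cnj[OF d3] in \<open>auto intro: differentiableI_vector\<close>)
    then have "(D has_vector_derivative vector_derivative D (at t)) (at t)"
      by (simp add: vector_derivative_works)
    moreover have "(Ln has_field_derivative inverse (D t)) (at (D t))"
      using Dre[of t] by (intro has_field_derivative_Ln) (auto simp: complex_nonpos_Reals_iff)
    ultimately have d4: "((\<lambda>t. Ln (D t)) has_vector_derivative vector_derivative D (at t) * inverse (D t)) (at t)"
      using field_vector_diff_chain_at by (fastforce simp: o_def)
    have "((\<lambda>w. of_real (ln r) + \<i> * w) has_field_derivative \<i>) (at (of_real t))"
      by (auto intro!: derivative_eq_intros)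
    then have d5: "((\<lambda>t. of_real (ln r) + \<i> * of_real t) has_vector_derivative \<i>) (at t)"
      by (rule has_vector_derivative_real_field)
    define d where "d = \<i> + d1 + vector_derivative D (at t) * inverse (D t)"
    have d: "(\<Lambda> has_vector_derivative d) (at t)"
      unfolding \<Lambda>_def d_def by (intro has_vector_derivative_add d5 d1 d4)
    \<comment> \<open>The summands have only been shown differentiable; the value of the derivative
      follows by differentiating \<open>exp (\<Lambda> t) = A t\<close>.\<close>
    have "(exp has_field_derivative exp (\<Lambda> t)) (at (\<Lambda> t))" by (rule DERIV_exp)
    from field_vector_diff_chain_at[OF d this]
    have "(A has_vector_derivative d * A t) (at t)" by (simp add: o_def exp\<Lambda>)
    then have "d * A t = \<i> * B t" using vector_derivative_unique_at dA by blast
    then have "d = \<i> * B t / A t" using Anz[of t] by (simp add: field_simps)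
    then show ?thesis using d by simp
  qed
  show ?thesis
  proof (rule that[of "\<lambda>t. Im (\<Lambda> t)"])
    show "circle_tangent h g (\<zeta> t) \<noteq> 0" for t using Anz by (simp add: A_def)
    show "circle_tangent h g (\<zeta> t) = of_real (cmod (circle_tangent h g (\<zeta> t))) * cis (Im (\<Lambda> t))" for t
      using exp\<Lambda>[of t] exp_eq_polar[of "\<Lambda> t"] by (metis A_def norm_exp_eq_Re)
    show "((\<lambda>t. Im (\<Lambda> t)) has_real_derivative
        Re (cnj (circle_tangent h g (\<zeta> t)) * circle_tangent_deriv h g (\<zeta> t)) / (cmod (circle_tangent h g (\<zeta> t)))\<^sup>2) (at t)" for t
    proof -
      have "Im (\<i> * B t / A t) = Re (cnj (A t) * B t) / (cmod (A t))\<^sup>2"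
        unfolding cmod_power2 by (simp add: Im_divide field_simps)
      then show ?thesis
        using bounded_linear.has_vector_derivative[OF bounded_linear_Im d\<Lambda>, of t]
        by (simp add: has_real_derivative_iff_has_vector_derivative A_def B_def)
    qed
    have per: "\<zeta> (t + 2*pi) = \<zeta> t" for t
      using exp_plus_2pin[of "\<i> * of_real t" 1] by (simp add: \<zeta>_def algebra_simps)
    show "Im (\<Lambda> (t + 2*pi)) = Im (\<Lambda> t) + 2*pi" for t
      by (simp add: \<Lambda>_def D_def per)
  qed
qed

text \<open>
  Since the tangent angle increases by exactly \<open>2 \<pi>\<close> along the circle, the distance to a line has at
  most two critical points on it; three intersection points would force three by Rolle.
\<close>

lemma shear_pair_line_circle:
  assumes sp: "shear_pair h g l" and r: "0 < r" "r < 3 - 2 * sqrt 2" and N: "N \<noteq> 0"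
    and t: "t1 < t2" "t2 < t3" "t3 < t1 + 2*pi"
    and f: "\<And>z. z \<in> \<D> \<Longrightarrow> f z = h z + cnj (g z)"
  defines "U \<equiv> \<lambda>t::real. Re (cnj N * f (complex_of_real r * exp (\<i> * of_real t)))"
  assumes eq: "U t1 = U t2" "U t2 = U t3"
  shows False
proof -
  define \<zeta> where "\<zeta> = (\<lambda>t::real. complex_of_real r * exp (\<i> * of_real t))"
  define A where "A = (\<lambda>t. circle_tangent h g (\<zeta> t))"
  have "sqrt 2 > 1" by simp
  then have r1: "r < 1" using r by linarith
  have hg: "h holomorphic_on \<D>" "g holomorphic_on \<D>" using sp by (auto simp: shear_pair_def)
  obtain \<tau> where \<tau>: "\<And>t. A t \<noteq> 0" "\<And>t. A t = of_real (cmod (A t)) * cis (\<tau> t)"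
    "\<And>t. (\<tau> has_real_derivative
        Re (cnj (A t) * circle_tangent_deriv h g (\<zeta> t)) / (cmod (A t))\<^sup>2) (at t)"
    "\<And>t. \<tau> (t + 2*pi) = \<tau> t + 2*pi"
    using shear_pair_tangent_angle[OF sp r(1) r1] unfolding A_def \<zeta>_def by metis
  have dU: "(U has_real_derivative Re (cnj N * (\<i> * A t))) (at t)" for t
  proof -
    have "((\<lambda>t. f (\<zeta> t)) has_vector_derivative \<i> * A t) (at t)"
      unfolding A_def \<zeta>_def using r r1 by (intro has_vector_derivative_harmonic_circle(1)[OF hg _ _ f]) auto
    then have "((\<lambda>t. Re (cnj N * f (\<zeta> t))) has_vector_derivative Re (cnj N * (\<i> * A t))) (at t)"
      by (intro bounded_linear.has_vector_derivative[OF bounded_linear_Re] has_vector_derivative_mult_right)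
    then show ?thesis by (simp add: has_real_derivative_iff_has_vector_derivative U_def \<zeta>_def)
  qed
  have per: "U (t + 2*pi) = U t" for t
    using exp_plus_2pin[of "\<i> * of_real t" 1] by (simp add: U_def algebra_simps)
  have rolle: "\<exists>s. a < s \<and> s < b \<and> Re (cnj N * (\<i> * A s)) = 0" if ab: "a < b" "U a = U b" for a b
  proof -
    have "\<exists>s>a. s < b \<and> DERIV U s :> 0"
      by (rule Rolle[OF ab]) (use dU in \<open>auto intro!: DERIV_continuous_on simp: real_differentiable_def intro: has_field_derivative_at_within\<close>)
    then show ?thesis using dU DERIV_unique by blast
  qed
  \<comment> \<open>The derivative of \<open>U\<close> is a nonzero multiple of sin (\<tau> - Arg
    N), so the critical points lie where the tangent angle is congruent to \<open>Arg N\<close>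
    modulo \<pi>.\<close>
  have ang: "\<exists>n::int. \<tau> s = Arg N + of_int n * pi" if "Re (cnj N * (\<i> * A s)) = 0" for s
  proof -
    have "N = of_real (cmod N) * cis (Arg N)" using rcis_cmod_Arg[of N] by (simp add: rcis_def)
    from arg_cong[OF this, of cnj] have cN: "cnj N = of_real (cmod N) * cis (- Arg N)" by (simp add: cis_cnj)
    obtain R where R: "A s = of_real R * cis (\<tau> s)" "R \<noteq> 0"
      using \<tau>(1,2)[of s] by (metis norm_eq_zero)
    have "Re (cnj N * (\<i> * A s)) = - (cmod N * R * sin (\<tau> s - Arg N))"
      unfolding cN R(1) by (simp add: sin_diff algebra_simps)
    then have "cmod N * R * sin (\<tau> s - Arg N) = 0" using that by simp
    then have "sin (\<tau> s - Arg N) = 0" using N R(2) by simp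
    then obtain n :: int where "\<tau> s - Arg N = of_int n * pi" using sin_zero_iff_int2 by blast
    then show ?thesis by (intro exI[of _ n]) simp
  qed
  have mono: "\<tau> a < \<tau> b" if "a < b" for a b
  proof (rule DERIV_pos_imp_increasing[OF that])
    fix t
    have "0 < Re (cnj (A t) * circle_tangent_deriv h g (\<zeta> t))"
      unfolding A_def by (rule shear_pair_curvature_pos[OF sp]) (use r in \<open>auto simp: \<zeta>_def norm_mult\<close>)
    then have "0 < Re (cnj (A t) * circle_tangent_deriv h g (\<zeta> t)) / (cmod (A t))\<^sup>2"
      using \<tau>(1) by (intro divide_pos_pos) auto
    then show "\<exists>y. DERIV \<tau> t :> y \<and> 0 < y" using \<tau>(3) by blast
  qed
  \<comment> \<open>The third Rolle interval closes the circle, from \<open>t3\<close> round to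
    \<open>t1 + 2*pi\<close>.\<close>
  have eq3: "U t3 = U (t1 + 2*pi)" using eq per[of t1] by simp
  obtain s1 where s1: "t1 < s1" "s1 < t2" "Re (cnj N * (\<i> * A s1)) = 0" using rolle[OF t(1) eq(1)] by blast
  obtain s2 where s2: "t2 < s2" "s2 < t3" "Re (cnj N * (\<i> * A s2)) = 0" using rolle[OF t(2) eq(2)] by blast
  obtain s3 where s3: "t3 < s3" "s3 < t1 + 2*pi" "Re (cnj N * (\<i> * A s3)) = 0" using rolle[OF t(3) eq3] by blast
  obtain n1 n2 n3 :: int where n: "\<tau> s1 = Arg N + of_int n1 * pi" "\<tau> s2 = Arg N + of_int n2 * pi" "\<tau> s3 = Arg N + of_int n3 * pi"
    using ang[OF s1(3)] ang[OF s2(3)] ang[OF s3(3)] by blast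
  \<comment> \<open>Less than one full turn separates \<open>s1\<close> from \<open>s3\<close>, so
    the three critical angles would give integers n1 < n2 < n3 < n1 + 2.\<close>
  have "\<tau> s1 < \<tau> s2" "\<tau> s2 < \<tau> s3" "\<tau> s3 < \<tau> s1 + 2*pi"
    using s1 s2 s3 unfolding \<tau>(4)[symmetric] by (auto intro!: mono)
  then have "of_int n1 * pi < of_int n2 * pi" "of_int n2 * pi < of_int n3 * pi" "of_int n3 * pi < of_int (n1 + 2) * pi"
    unfolding n by (auto simp: algebra_simps)
  then show False by simp
qed

text \<open>If a chord from \<open>p\<close> to \<open>q\<close> leaves the image at
  \<open>m\<close>, its line crosses the boundary at least three times: at or before
  \<open>p\<close>, between \<open>p\<close> and \<open>m\<close>, and at or after \<open>q\<close>.
  Boundary points come from the circle, which a line meets at most twice.\<close>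

lemma shear_pair_convex_image:
  assumes sp: "shear_pair h g l" and r: "0 < r" "r < 3 - 2 * sqrt 2"
    and f: "\<And>z. z \<in> \<D> \<Longrightarrow> f z = h z + cnj (g z)" and inj: "inj_on f \<D>"
  shows "convex (f ` ball 0 r)"
proof (rule ccontr)
  assume "\<not> convex (f ` ball 0 r)"
  define \<Omega> where "\<Omega> = f ` ball 0 r"
  have "sqrt 2 > 1" by simp
  then have r1: "r < 1" using r by linarith
  have hg: "h holomorphic_on \<D>" "g holomorphic_on \<D>" using sp by (auto simp: shear_pair_def)
  have cont: "continuous_on \<D> f"
  proof -
    have "continuous_on \<D> (\<lambda>z. h z + cnj (g z))"
      by (intro continuous_intros holomorphic_on_imp_continuous_on hg)
    then show ?thesis by (rule continuous_on_eq) (use f in auto)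
  qed
  have sub: "cball 0 r \<subseteq> \<D>" "ball 0 r \<subseteq> \<D>" using r1 by auto
  have op: "open \<Omega>"
    unfolding \<Omega>_def using continuous_on_subset[OF cont sub(2)] inj_on_subset[OF inj sub(2)]
    by (intro invariance_of_domain) auto
  have cpt: "compact (f ` cball 0 r)"
    by (intro compact_continuous_image continuous_on_subset[OF cont sub(1)]) auto
  have cl: "closure \<Omega> \<subseteq> f ` cball 0 r"
    unfolding \<Omega>_def by (intro closure_minimal image_mono compact_imp_closed cpt) auto
  obtain p q m where pq: "p \<in> \<Omega>" "q \<in> \<Omega>" "m \<in> closed_segment p q" "m \<notin> \<Omega>"
    using \<open>\<not> convex (f ` ball 0 r)\<close> unfolding \<Omega>_def[symmetric] convex_contains_segment by blast
  then have neq: "p \<noteq> q" by auto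
  define line where "line = (\<lambda>s::real. p + of_real s * (q - p))"
  define S where "S = line -` \<Omega>"
  have contl: "continuous_on UNIV line" unfolding line_def by (intro continuous_intros)
  have Sop: "open S" unfolding S_def using op contl by (intro open_vimage)
  obtain \<mu> where \<mu>: "0 \<le> \<mu>" "\<mu> \<le> 1" "m = line \<mu>"
    using pq(3) by (auto simp: in_segment line_def scaleR_conv_of_real algebra_simps)
  have S01: "0 \<in> S" "1 \<in> S" "\<mu> \<notin> S" using pq \<mu> by (auto simp: S_def line_def)
  have \<mu>01: "0 < \<mu>" "\<mu> < 1" using S01 \<mu> by (auto simp: less_le)
  obtain M where M: "\<And>w. w \<in> \<Omega> \<Longrightarrow> cmod w \<le> M"
    using compact_imp_bounded[OF cpt] by (force simp: bounded_iff \<Omega>_def)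
  have far: "s \<notin> S" if s: "\<bar>s\<bar> * cmod (q - p) > M + cmod p" for s
  proof
    assume "s \<in> S"
    then have "cmod (line s) \<le> M" using M by (simp add: S_def)
    moreover have "cmod (of_real s * (q - p)) \<le> cmod (line s) + cmod p"
      using norm_triangle_ineq4[of "line s" p] by (simp add: line_def)
    ultimately show False using s by (simp add: norm_mult)
  qed
  \<comment> \<open>From parameter distance \<open>K\<close> on, the line is outside a disk that
    contains the bounded image. On the right \<open>K + 1\<close> is used, which is certainly at
    least 1, the parameter of \<open>q\<close>.\<close>
  define K where "K = (M + cmod p) / cmod (q - p) + 1"
  have K: "K * cmod (q - p) > M + cmod p" using neq by (simp add: K_def field_simps)
  have Mp: "M \<ge> 0" using M[OF pq(1)] norm_ge_zero order_trans by blast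
  have K1: "K > 0" unfolding K_def using Mp by (intro add_nonneg_pos) auto
  have nS: "- K \<notin> S" "K + 1 \<notin> S"
  proof -
    show "- K \<notin> S" using K K1 by (intro far) simp
    have "K * cmod (q - p) \<le> (K + 1) * cmod (q - p)" by (intro mult_right_mono) auto
    then show "K + 1 \<notin> S" using K K1 by (intro far) auto
  qed
  have fr: "\<exists>s\<in>T. s \<in> frontier S" if "connected T" "a \<in> T" "a \<in> S" "b \<in> T" "b \<notin> S" for T a b
    using connected_Int_frontier[of T S] that by blast
  obtain s1 where s1: "s1 \<le> 0" "s1 \<in> frontier S"
    using fr[of "{..0}" 0 "-K"] S01 nS K1 by auto
  obtain s2 where s2: "0 \<le> s2" "s2 \<le> \<mu>" "s2 \<in> frontier S"
    using fr[of "{0..\<mu>}" 0 \<mu>] S01 \<mu> by auto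
  obtain s3 where s3: "1 \<le> s3" "s3 \<in> frontier S"
  proof (cases "K + 1 \<ge> 1")
    case True
    then show ?thesis using that fr[of "{1..}" 1 "K+1"] S01 nS by auto
  qed (use K1 in auto)
  have nfr: "s \<notin> S" if "s \<in> frontier S" for s using that Sop by (auto simp: frontier_def interior_open)
  have lt: "s1 < s2" "s2 < s3" using s1 s2 s3 \<mu>01 nfr S01 by (auto simp: less_le)
  \<comment> \<open>Boundary points of \<open>S\<close> map into the closure of the image, hence
    into the image of the closed disk, but not into the open image itself; this leaves the
    circle.\<close>
  have circ: "\<exists>t\<in>{-pi<..pi}. line s = f (of_real r * exp (\<i> * of_real t))" if s: "s \<in> frontier S" for s
  proof -
    have "line s \<in> line ` closure S" using s by (auto simp: frontier_def)
    also have "\<dots> \<subseteq> closure (line ` S)"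
      by (intro image_closure_subset continuous_on_subset[OF contl] closure_subset) auto
    also have "\<dots> \<subseteq> closure \<Omega>" by (intro closure_mono) (auto simp: S_def)
    finally obtain z where z: "z \<in> cball 0 r" "line s = f z" using cl by auto
    have "z \<notin> ball 0 r" using nfr[OF s] z by (auto simp: S_def \<Omega>_def)
    then have "cmod z = r" using z by auto
    then have "z = of_real r * exp (\<i> * of_real (Arg z))"
      using rcis_cmod_Arg[of z] by (simp add: rcis_def cis_conv_exp)
    then show ?thesis using z Arg_bounded[of z] by (intro bexI[of _ "Arg z"]) auto
  qed
  \<comment> \<open>A normal of the line: pairing with it is constant along the line, so the
    crossings give equal values of \<open>U\<close>.\<close>
  define N where "N = \<i> * (q - p)"
  have N: "N \<noteq> 0" using neq by (simp add: N_def)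
  have lineN: "Re (cnj N * line s) = Re (cnj N * p)" for s
    by (simp add: N_def line_def algebra_simps)
  have linj: "line a = line b \<longleftrightarrow> a = b" for a b using neq by (auto simp: line_def)
  obtain a b c where abc: "a \<in> {-pi<..pi}" "b \<in> {-pi<..pi}" "c \<in> {-pi<..pi}"
    "line s1 = f (of_real r * exp (\<i> * of_real a))"
    "line s2 = f (of_real r * exp (\<i> * of_real b))"
    "line s3 = f (of_real r * exp (\<i> * of_real c))"
    using circ s1 s2 s3 by metis
  define U where "U = (\<lambda>t::real. Re (cnj N * f (complex_of_real r * exp (\<i> * of_real t))))"
  have U: "U a = Re (cnj N * p)" "U b = Re (cnj N * p)" "U c = Re (cnj N * p)"
    using lineN by (simp_all add: U_def flip: abc(4-6))
  have dist: "a \<noteq> b" "b \<noteq> c" "a \<noteq> c" using abc(4-6) lt linj by (metis less_irrefl less_trans)+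
  have no: False if "x < y" "y < z" "{x,y,z} \<subseteq> {a,b,c}" for x y z
  proof -
    have "z < x + 2*pi" using that abc(1-3) by auto
    moreover have "U x = U y" "U y = U z" using that U by auto
    ultimately show False
      using shear_pair_line_circle[OF sp r N that(1,2) _ f] unfolding U_def by blast
  qed
  consider "a < b" "b < c" | "a < c" "c < b" | "b < a" "a < c" | "b < c" "c < a" | "c < a" "a < b" | "c < b" "b < a"
    using dist by linarith
  then show False by cases (use no in blast)+
qed

section \<open>Transfer to the full affine class\<close>

text \<open>\<open>c\<close> is identified with the coefficient in the curvature bounds: the second
  part of \<open>f\<close> is g + cnj c h, whose derivative at 0 is \<open>cnj c\<close> by the
  normalisations of \<open>g\<close> and \<open>h\<close>.\<close>

lemma class_SH_S_shear_pair:
  assumes "f \<in> class_SH_S"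
  obtains h g l c f0 where "shear_pair h g l" "cmod c < 1" "inj_on f0 \<D>"
    "\<forall>z\<in>\<D>. f0 z = h z + cnj (g z)" "\<forall>z\<in>\<D>. f z = f0 z + c * cnj (f0 z)"
    "dzbar f 0 = c"
proof -
  obtain f0 c where f0: "f0 \<in> class_SH0_S" "cmod c < 1" "\<And>z. z \<in> \<D> \<Longrightarrow> f z = f0 z + c * cnj (f0 z)"
    using assms by (auto simp: class_SH_S_def)
  obtain h g l where hg: "shear_pair h g l" "\<And>z. z \<in> \<D> \<Longrightarrow> f0 z = h z + cnj (g z)" "inj_on f0 \<D>"
    using class_SH0_S_shear_pair[OF f0(1)] by blast
  have hol: "h holomorphic_on \<D>" "g holomorphic_on \<D>" and n: "deriv h 0 = 1" "deriv g 0 = 0"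
    using hg(1) by (auto simp: shear_pair_def)
  have "dzbar f 0 = cnj (deriv (\<lambda>z. g z + cnj c * h z) 0)"
  proof (rule dzbar_harmonic[of "\<lambda>z. h z + c * g z"])
    show "f z = h z + c * g z + cnj (g z + cnj c * h z)" if "z \<in> \<D>" for z
      using f0(3)[OF that] hg(2)[OF that] by (simp add: algebra_simps)
  qed (auto intro!: holomorphic_intros hol)
  also have "deriv (\<lambda>z. g z + cnj c * h z) 0 = deriv g 0 + cnj c * deriv h 0"
    by (intro DERIV_imp_deriv DERIV_add DERIV_cmult holomorphic_derivI[OF hol(1) open_ball]
        holomorphic_derivI[OF hol(2) open_ball]) auto
  finally have "dzbar f 0 = c" using n by simp
  then show ?thesis using that[OF hg(1) f0(2) hg(3)] hg(2) f0(3) by simp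
qed

text \<open>Strict positivity of the curvature is available only below the critical radius. Any two
  points of the critical disk already lie in a smaller concentric one, so convexity passes to the
  union; the affine map preserves it, and openness is invariance of domain.\<close>

lemma class_SH_S_convex_image:
  assumes "f \<in> class_SH_S"
  shows "convex_domain (f ` ball 0 (3 - 2 * sqrt 2))"
proof -
  obtain h g l c f0 where sp: "shear_pair h g l" "cmod c < 1" "inj_on f0 \<D>"
    "\<forall>z\<in>\<D>. f0 z = h z + cnj (g z)" "\<forall>z\<in>\<D>. f z = f0 z + c * cnj (f0 z)"
    by (rule class_SH_S_shear_pair[OF assms])
  note f = sp(1-3) sp(4,5)[rule_format]
  define \<rho> :: real where "\<rho> = 3 - 2 * sqrt 2"
  have "sqrt 2 < 3 / 2" by (rule real_less_lsqrt) (auto simp: power2_eq_square)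
  moreover have "sqrt 2 > 1" by simp
  ultimately have \<rho>: "0 < \<rho>" "\<rho> < 1" unfolding \<rho>_def by linarith+
  have sub: "ball 0 \<rho> \<subseteq> \<D>" using \<rho> by auto
  have hol: "h holomorphic_on \<D>" "g holomorphic_on \<D>" using f(1) by (auto simp: shear_pair_def)
  define T where "T = (\<lambda>w. w + c * cnj w)"
  have lin: "linear T" unfolding T_def by (rule linearI) (auto simp: algebra_simps scaleR_conv_of_real)
  have injT: "inj T"
  proof (rule linear_injective_0[OF lin, THEN iffD2, rule_format])
    fix w assume "T w = 0"
    then have "w = - (c * cnj w)" by (simp add: T_def eq_neg_iff_add_eq_0)
    then have "cmod w = cmod c * cmod w" by (metis complex_mod_cnj norm_minus_cancel norm_mult)
    then show "w = 0" using f(2) by auto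
  qed
  have "convex (f0 ` ball 0 \<rho>)"
  proof (rule convexI)
    fix p q :: complex and u v :: real
    assume pq: "p \<in> f0 ` ball 0 \<rho>" "q \<in> f0 ` ball 0 \<rho>" and uv: "0 \<le> u" "0 \<le> v" "u + v = 1"
    obtain x y where xy: "p = f0 x" "q = f0 y" "cmod x < \<rho>" "cmod y < \<rho>" using pq by auto
    obtain r where r: "max (cmod x) (cmod y) < r" "r < \<rho>"
      using dense[of "max (cmod x) (cmod y)" \<rho>] xy by auto
    then have "0 < r" using le_less_trans[OF norm_ge_zero[of x]] by simp
    have "convex (f0 ` ball 0 r)"
      by (rule shear_pair_convex_image[OF f(1) _ _ f(4) f(3)]) (use r \<open>0 < r\<close> in \<open>auto simp: \<rho>_def\<close>)
    then have "u *\<^sub>R p + v *\<^sub>R q \<in> f0 ` ball 0 r"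
      using uv xy r by (intro convexD) auto
    then show "u *\<^sub>R p + v *\<^sub>R q \<in> f0 ` ball 0 \<rho>" using r by auto
  qed
  then have "convex (T ` f0 ` ball 0 \<rho>)" by (rule convex_linear_image[OF lin])
  moreover have "f ` ball 0 \<rho> = T ` f0 ` ball 0 \<rho>"
    using f(5) sub by (auto simp: T_def image_image intro!: image_cong)
  ultimately have cv: "convex (f ` ball 0 \<rho>)" by simp
  have "continuous_on \<D> (\<lambda>z. (h z + cnj (g z)) + c * cnj (h z + cnj (g z)))"
    by (intro continuous_intros holomorphic_on_imp_continuous_on hol)
  then have "continuous_on \<D> f" by (rule continuous_on_eq) (use f in auto)
  moreover have "inj_on f \<D>"
  proof (rule inj_onI)
    fix x y assume "x \<in> \<D>" "y \<in> \<D>" "f x = f y"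
    then have "T (f0 x) = T (f0 y)" using f(5) by (simp add: T_def)
    then show "x = y" using injT f(3) \<open>x \<in> \<D>\<close> \<open>y \<in> \<D>\<close> by (auto dest: injD inj_onD)
  qed
  ultimately have "open (f ` ball 0 \<rho>)"
    by (intro invariance_of_domain continuous_on_subset[OF _ sub] inj_on_subset[OF _ sub]) auto
  then show ?thesis
    using cv convex_connected[OF cv] \<rho> unfolding convex_domain_def \<rho>_def[symmetric] by auto
qed

section \<open>The harmonic Koebe function\<close>

text \<open>The conformal map of the disk onto the right half-plane, where the extremal function
  becomes polynomial.\<close>

definition cayley :: "complex \<Rightarrow> complex" where
  "cayley z = (1 + z) / (1 - z)"

lemma cayley_Re_pos:
  assumes "z \<in> \<D>"
  shows "0 < Re (cayley z)"
proof -
  have "z \<noteq> 1" using assms by auto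
  then have "0 < (cmod (1 - z))\<^sup>2" by simp
  moreover have "Re (cayley z) = (1 - (cmod z)\<^sup>2) / (cmod (1 - z))\<^sup>2"
    unfolding cayley_def cmod_power2 by (simp add: Re_divide power2_eq_square algebra_simps)
  moreover have "(cmod z)\<^sup>2 < 1" using assms by (simp add: abs_square_less_1)
  ultimately show ?thesis by simp
qed

text \<open>The inverse map in denominator-free form. It also turns the quotient of the derivatives
  of \<open>koebe_g\<close> and \<open>koebe_h\<close> into the dilatation \<open>z\<close>.\<close>

lemma cayley_times:
  assumes "z \<in> \<D>"
  shows "z * (cayley z + 1) = cayley z - 1"
proof -
  have "1 - z \<noteq> 0" using assms by auto
  then show ?thesis unfolding cayley_def by (simp add: field_simps)
qed

lemma inj_on_cayley: "inj_on cayley \<D>"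
proof (rule inj_onI)
  fix z w assume zw: "z \<in> \<D>" "w \<in> \<D>" "cayley z = cayley w"
  then have "z * (cayley z + 1) = w * (cayley z + 1)" using cayley_times by metis
  moreover have "cayley z + 1 \<noteq> 0" using cayley_Re_pos[OF zw(1)] by (auto simp: complex_eq_iff)
  ultimately show "z = w" by simp
qed

lemma cayley_surj:
  assumes "0 < Re \<xi>"
  shows "cayley ((\<xi> - 1) / (\<xi> + 1)) = \<xi>"
proof -
  have "\<xi> + 1 \<noteq> 0" using assms by (auto simp: complex_eq_iff)
  then have "1 + (\<xi> - 1) / (\<xi> + 1) = 2 * \<xi> / (\<xi> + 1)" "1 - (\<xi> - 1) / (\<xi> + 1) = 2 / (\<xi> + 1)"
    by (simp_all add: field_simps)
  then show ?thesis using \<open>\<xi> + 1 \<noteq> 0\<close> unfolding cayley_def by simp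
qed

lemma has_field_derivative_cayley:
  assumes "z \<in> \<D>"
  shows "(cayley has_field_derivative 2 / (1 - z)\<^sup>2) (at z)"
proof -
  have "1 - z \<noteq> 0" using assms by auto
  then show ?thesis
    unfolding cayley_def[abs_def] by (auto intro!: derivative_eq_intros simp: power2_eq_square)
qed

text \<open>
  The harmonic Koebe function is the horizontal shear of the Koebe function
  \<open>h - g = z / (1 - z)\<^sup>2\<close> with dilatation \<open>g' / h' = z\<close>; in the half-plane variable \<open>\<zeta>\<close> it
  reads \<open>Re (\<zeta>\<^sup>3 - 1) / 6 + \<i> Im \<zeta>\<^sup>2 / 4\<close>.
\<close>

definition koebe_h :: "complex \<Rightarrow> complex" where
  "koebe_h z = (cayley z ^ 3 - 1) / 12 + ((cayley z)\<^sup>2 - 1) / 8"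

definition koebe_g :: "complex \<Rightarrow> complex" where
  "koebe_g z = (cayley z ^ 3 - 1) / 12 - ((cayley z)\<^sup>2 - 1) / 8"

definition harmonic_koebe :: "complex \<Rightarrow> complex" where
  "harmonic_koebe z = koebe_h z + cnj (koebe_g z)"

lemma harmonic_koebe_Re: "Re (harmonic_koebe z) = (Re (cayley z) ^ 3 - 3 * Re (cayley z) * (Im (cayley z))\<^sup>2 - 1) / 6"
  by (simp add: harmonic_koebe_def koebe_h_def koebe_g_def power2_eq_square power3_eq_cube field_simps)

lemma harmonic_koebe_Im: "Im (harmonic_koebe z) = Re (cayley z) * Im (cayley z) / 2"
  by (simp add: harmonic_koebe_def koebe_h_def koebe_g_def power2_eq_square power3_eq_cube field_simps)

lemma has_field_derivative_koebe_parts: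
  assumes z: "z \<in> \<D>"
  shows "(koebe_h has_field_derivative cayley z * (cayley z + 1) / (2 * (1 - z)\<^sup>2)) (at z)"
    and "(koebe_g has_field_derivative cayley z * (cayley z - 1) / (2 * (1 - z)\<^sup>2)) (at z)"
proof -
  have nz: "1 - z \<noteq> 0" using z by auto
  show "(koebe_h has_field_derivative cayley z * (cayley z + 1) / (2 * (1 - z)\<^sup>2)) (at z)"
    unfolding koebe_h_def[abs_def] using nz
    by (auto intro!: derivative_eq_intros has_field_derivative_cayley[OF z])
      (simp add: algebra_simps add_divide_distrib diff_divide_distrib power2_eq_square)
  show "(koebe_g has_field_derivative cayley z * (cayley z - 1) / (2 * (1 - z)\<^sup>2)) (at z)"
    unfolding koebe_g_def[abs_def] using nz
    by (auto intro!: derivative_eq_intros has_field_derivative_cayley[OF z])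
      (simp add: algebra_simps add_divide_distrib diff_divide_distrib power2_eq_square)
qed

text \<open>In the half-plane the imaginary part fixes the product k = a b, and then a^3 - 3 a b^2 =
  a^3 - 3 k^2 / a is strictly increasing in a > 0. So the real part determines a, and k determines
  b.\<close>

lemma inj_on_harmonic_koebe: "inj_on harmonic_koebe \<D>"
proof -
  have aux: "\<not> a < c" if pos: "0 < a" "0 < c" and eq: "a * b = c * d" "a^3 - 3 * a * b\<^sup>2 = c^3 - 3 * c * d\<^sup>2"
    for a b c d :: real
  proof
    assume ac: "a < c"
    have "a^3 < c^3" using ac pos by (intro power_strict_mono) auto
    moreover have "c * d\<^sup>2 \<le> a * b\<^sup>2"
    proof -
      have "(c * d\<^sup>2) * c = (a * b\<^sup>2) * a"
        using eq(1) by (metis power2_eq_square power_mult_distrib mult.assoc mult.commute)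
      also have "\<dots> \<le> (a * b\<^sup>2) * c" using ac pos by (intro mult_left_mono) auto
      finally show ?thesis using pos(2) by (rule mult_right_le_imp_le)
    qed
    ultimately show False using eq(2) by linarith
  qed
  show ?thesis
  proof (rule inj_onI)
    fix z w assume zw: "z \<in> \<D>" "w \<in> \<D>" "harmonic_koebe z = harmonic_koebe w"
    let ?a = "Re (cayley z)" and ?b = "Im (cayley z)" and ?c = "Re (cayley w)" and ?d = "Im (cayley w)"
    have pos: "0 < ?a" "0 < ?c" using zw cayley_Re_pos by auto
    have eq: "?a * ?b = ?c * ?d" "?a^3 - 3 * ?a * ?b\<^sup>2 = ?c^3 - 3 * ?c * ?d\<^sup>2"
      using harmonic_koebe_Re[of z] harmonic_koebe_Re[of w] harmonic_koebe_Im[of z] harmonic_koebe_Im[of w] zw(3)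
      by auto
    have "?a = ?c" using aux[OF pos eq] aux[OF pos(2,1) eq[symmetric]] by linarith
    moreover from this have "?b = ?d" using eq(1) pos by simp
    ultimately have "cayley z = cayley w" by (simp add: complex_eq_iff)
    then show "z = w" using inj_onD[OF inj_on_cayley] zw(1,2) by blast
  qed
qed

text \<open>The choice is theta = \<pi> and c = 0. Here h - g is a quarter of the squared Cayley map
  minus 1, and squaring is injective on the right half-plane.\<close>

lemma harmonic_koebe_in_class: "harmonic_koebe \<in> class_SH_S"
proof -
  note d = has_field_derivative_koebe_parts
  have hol: "koebe_h holomorphic_on \<D>" "koebe_g holomorphic_on \<D>"
    unfolding holomorphic_on_open[OF open_ball] using d by blast+
  have c0: "cayley 0 = 1" by (simp add: cayley_def)
  have cp: "canonical_parts harmonic_koebe koebe_h koebe_g"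
    using hol DERIV_imp_deriv[OF d(1), of 0]
    by (simp add: canonical_parts_def harmonic_koebe_def koebe_h_def koebe_g_def c0)
  have sense: "0 < (cmod (deriv koebe_h z))\<^sup>2 - (cmod (deriv koebe_g z))\<^sup>2" if z: "z \<in> \<D>" for z
  proof -
    have dh: "deriv koebe_h z = cayley z * (cayley z + 1) / (2 * (1 - z)\<^sup>2)"
      by (rule DERIV_imp_deriv[OF d(1)[OF z]])
    have dg: "deriv koebe_g z = z * deriv koebe_h z"
      unfolding dh DERIV_imp_deriv[OF d(2)[OF z]] cayley_times[OF z, symmetric] by simp
    have "1 - z \<noteq> 0" using z by auto
    moreover have "cayley z \<noteq> 0" "cayley z + 1 \<noteq> 0" using cayley_Re_pos[OF z] by (auto simp: complex_eq_iff)
    ultimately have "0 < (cmod (deriv koebe_h z))\<^sup>2" unfolding dh by simp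
    moreover have "(cmod z)\<^sup>2 < 1" using z by (simp add: abs_square_less_1)
    ultimately have "(cmod z)\<^sup>2 * (cmod (deriv koebe_h z))\<^sup>2 < 1 * (cmod (deriv koebe_h z))\<^sup>2"
      by (intro mult_strict_right_mono)
    then show ?thesis by (simp add: dg norm_mult power_mult_distrib)
  qed
  have "dzbar harmonic_koebe 0 = 0"
    using dzbar_harmonic[OF hol, of harmonic_koebe 0] DERIV_imp_deriv[OF d(2), of 0]
    by (simp add: harmonic_koebe_def c0)
  moreover have "(\<lambda>z. koebe_h z + exp (\<i> * of_real pi) * koebe_g z) \<in> class_S"
  proof -
    have "inj_on (\<lambda>z. koebe_h z + - 1 * koebe_g z) \<D>"
    proof (rule inj_onI)
      fix z w assume zw: "z \<in> \<D>" "w \<in> \<D>" "koebe_h z + - 1 * koebe_g z = koebe_h w + - 1 * koebe_g w"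
      then have "(cayley z)\<^sup>2 = (cayley w)\<^sup>2" by (simp add: koebe_h_def koebe_g_def field_simps)
      then have "cayley z = cayley w \<or> cayley z = - cayley w" by (simp add: power2_eq_iff)
      then have "cayley z = cayley w" using cayley_Re_pos[OF zw(1)] cayley_Re_pos[OF zw(2)] by auto
      then show "z = w" using inj_onD[OF inj_on_cayley] zw(1,2) by blast
    qed
    moreover have "deriv (\<lambda>z. koebe_h z + - 1 * koebe_g z) 0 = 1 + - 1 * 0"
      using d(1)[of 0] d(2)[of 0] by (intro DERIV_imp_deriv DERIV_add DERIV_cmult) (simp_all add: c0)
    moreover have "(\<lambda>z. koebe_h z + - 1 * koebe_g z) holomorphic_on \<D>"
      by (intro holomorphic_intros hol)
    ultimately show ?thesis
      by (simp add: class_S_def koebe_h_def koebe_g_def c0 flip: cis_conv_exp)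
  qed
  ultimately have "harmonic_koebe \<in> class_SH0_S"
    unfolding class_SH0_S_def class_SH0_def class_SH_def class_H_def sense_preserving_def
    using cp sense inj_on_harmonic_koebe by blast
  then show ?thesis
    unfolding class_SH_S_def by (auto intro!: bexI[of _ harmonic_koebe] bexI[of _ 0])
qed

text \<open>
  In the half-plane variable \<open>ball 0 R\<close> is the disk with leftmost point \<open>a = (1 - R) / (1 + R)\<close>,
  and \<open>R > 3 - 2 * sqrt 2\<close> amounts to \<open>a < 1 / sqrt 2\<close>. The points \<open>1 / sqrt 2 \<plusminus> \<i> y\<close> below are
  chosen to have the same real part of the image as \<open>a\<close>.
\<close>

lemma harmonic_koebe_not_convex:
  assumes R: "3 - 2 * sqrt 2 < R" "R \<le> 1"
  shows "\<not> convex (harmonic_koebe ` ball 0 R)"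
proof
  assume conv: "convex (harmonic_koebe ` ball 0 R)"
  define c where "c = sqrt 2 / 2"
  have c: "0 < c" "c\<^sup>2 = 1/2" by (simp_all add: c_def power_divide)
  have "sqrt 2 < 3 / 2" by (rule real_less_lsqrt) (auto simp: power2_eq_square)
  then have R0: "0 < R" using R by linarith
  define a where "a = (1 - R) / (1 + R)"
  have a0: "0 \<le> a" using R R0 by (simp add: a_def)
  have Ra: "R * (1 + a) = 1 - a" using R0 by (simp add: a_def field_simps)
  have ac: "a < c"
  proof -
    have "(3 - 2 * sqrt 2) * (1 + c) < R * (1 + c)" using R c by (intro mult_strict_right_mono) auto
    moreover have "(3 - 2 * sqrt 2) * (1 + c) = 1 - c" by (simp add: c_def field_simps)
    ultimately have "1 - R < c * (1 + R)" by (simp add: algebra_simps)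
    then show ?thesis using R0 by (simp add: a_def divide_less_eq)
  qed
  have c3: "c^3 = c / 2" using c by (simp add: power3_eq_cube power2_eq_square)
  define s where "s = (c^3 - a^3) / (3 * c)"
  have "a^3 \<le> c^3" using a0 ac by (intro power_mono) auto
  then have s0: "0 \<le> s" using c by (simp add: s_def)
  have s: "3 * c * s = c^3 - a^3" using c by (simp add: s_def)
  define \<xi> where "\<xi> = Complex c (sqrt s)"
  define z where "z = (\<xi> - 1) / (\<xi> + 1)"
  \<comment> \<open>This is \<open>cmod (\<xi> - 1) < R * cmod (\<xi> + 1)\<close>, squared and with
    R = (1 - a) / (1 + a). After multiplication by 3c and substitution of \<open>s\<close> the
    difference of the two sides contains the factor c - a.\<close>
  have mem: "a * (c\<^sup>2 + 1 + s) < c * (1 + a\<^sup>2)"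
  proof -
    have "a * (2 + a * c + a\<^sup>2) < 3 * c"
    proof -
      have "a * (2 + a * c + a\<^sup>2) \<le> a * (2 + c * c + c\<^sup>2)"
        using a0 ac c by (intro mult_left_mono add_mono mult_right_mono power_mono) auto
      also have "2 + c * c + c\<^sup>2 = 3" using c by (simp add: power2_eq_square)
      finally show ?thesis using ac by simp
    qed
    then have "(c - a) * (a * (2 + a * c + a\<^sup>2)) < (c - a) * (3 * c)"
      using ac by (intro mult_strict_left_mono) auto
    moreover have "3 * c * (c * (1 + a\<^sup>2)) - 3 * c * (a * (c\<^sup>2 + 1 + s)) = (c - a) * (3 * c) - (c - a) * (a * (2 + a * c + a\<^sup>2))"
    proof -
      have "3 * c * (a * (c\<^sup>2 + 1 + s)) = a * (3 * c * c\<^sup>2 + 3 * c + 3 * c * s)" by (simp add: algebra_simps)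
      also have "\<dots> = a * (3 * c * (1/2) + 3 * c + (c / 2 - a^3))" unfolding s c3 c(2) ..
      also have "\<dots> = 5 * (a * c) - a^4" by (simp add: power3_eq_cube power4_eq_xxxx algebra_simps)
      finally have 1: "3 * c * (a * (c\<^sup>2 + 1 + s)) = 5 * (a * c) - a^4" .
      have "3 * c * (c * (1 + a\<^sup>2)) = 3 * (c\<^sup>2 * (1 + a\<^sup>2))" by (simp add: power2_eq_square)
      then have 2: "3 * c * (c * (1 + a\<^sup>2)) = 3/2 + 3/2 * a\<^sup>2" unfolding c(2) by simp
      have "(c - a) * (3 * c) - (c - a) * (a * (2 + a * c + a\<^sup>2))
          = 3 * c\<^sup>2 - 5 * (a * c) - a\<^sup>2 * c\<^sup>2 + 2 * a\<^sup>2 + a^4"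
        by (simp add: power2_eq_square power4_eq_xxxx algebra_simps)
      then have 3: "(c - a) * (3 * c) - (c - a) * (a * (2 + a * c + a\<^sup>2)) = 3/2 - 5 * (a * c) + 3/2 * a\<^sup>2 + a^4"
        unfolding c(2) by simp
      show ?thesis unfolding 1 2 3 by simp
    qed
    ultimately have "3 * c * (a * (c\<^sup>2 + 1 + s)) < 3 * c * (c * (1 + a\<^sup>2))" by linarith
    then show ?thesis by (rule mult_left_less_imp_less) (use c(1) in simp)
  qed
  have zR: "z \<in> ball 0 R"
  proof -
    have n: "(cmod (\<xi> - 1))\<^sup>2 = (c - 1)\<^sup>2 + s" "(cmod (\<xi> + 1))\<^sup>2 = (c + 1)\<^sup>2 + s"
      unfolding cmod_power2 using s0 by (simp_all add: \<xi>_def)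
    have "(1 + a)\<^sup>2 * ((c - 1)\<^sup>2 + s) < (1 - a)\<^sup>2 * ((c + 1)\<^sup>2 + s)"
      using mem by (simp add: power2_eq_square algebra_simps)
    then have "((1 + a) * cmod (\<xi> - 1))\<^sup>2 < (R * (1 + a) * cmod (\<xi> + 1))\<^sup>2"
      unfolding Ra power_mult_distrib n .
    then have "(1 + a) * cmod (\<xi> - 1) < R * (1 + a) * cmod (\<xi> + 1)"
      by (rule power2_less_imp_less) (use R0 a0 in auto)
    then have "(1 + a) * cmod (\<xi> - 1) < (1 + a) * (R * cmod (\<xi> + 1))" by (simp add: mult_ac)
    then have "cmod (\<xi> - 1) < R * cmod (\<xi> + 1)" using a0 by simp
    moreover have "\<xi> + 1 \<noteq> 0" using c by (auto simp: \<xi>_def complex_eq_iff)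
    ultimately show ?thesis by (simp add: z_def norm_divide divide_less_eq)
  qed
  have cz: "cayley z = \<xi>" unfolding z_def by (rule cayley_surj) (use c in \<open>simp add: \<xi>_def\<close>)
  have ReK: "Re (harmonic_koebe z) = (a^3 - 1) / 6"
    unfolding harmonic_koebe_Re cz using s s0 by (simp add: \<xi>_def)
  have cnjK: "harmonic_koebe (cnj z) = cnj (harmonic_koebe z)"
    by (simp add: harmonic_koebe_def koebe_h_def koebe_g_def cayley_def)
  \<comment> \<open>The midpoint of the two conjugate values is real. A preimage \<open>y\<close> in
    the disk would have a real positive Cayley value with cube \<open>a^3\<close>, hence equal to
    \<open>a\<close>, which places \<open>y\<close> on the circle of radius \<open>R\<close> instead
    of inside it.\<close>
  have "(1/2) *\<^sub>R harmonic_koebe z + (1/2) *\<^sub>R harmonic_koebe (cnj z) \<in> harmonic_koebe ` ball 0 R"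
    by (rule convexD[OF conv]) (use zR in auto)
  also have "(1/2) *\<^sub>R harmonic_koebe z + (1/2) *\<^sub>R harmonic_koebe (cnj z) = of_real ((a^3 - 1) / 6)"
    using ReK by (simp add: cnjK complex_eq_iff)
  finally obtain y where y: "cmod y < R" "harmonic_koebe y = of_real ((a^3 - 1) / 6)" by auto
  have yD: "y \<in> \<D>" using y R by auto
  define t where "t = Re (cayley y)"
  have t0: "0 < t" using cayley_Re_pos[OF yD] by (simp add: t_def)
  have Im0: "Im (cayley y) = 0" using harmonic_koebe_Im[of y] y(2) t0 by (simp add: t_def)
  then have "t^3 = a^3" using harmonic_koebe_Re[of y] y(2) by (simp add: t_def)
  then have ta: "t = a" using t0 a0 power_eq_imp_eq_base[of t 3 a] by simp
  have "cayley y = of_real t" using Im0 by (simp add: t_def complex_eq_iff)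
  then have "y * of_real (t + 1) = of_real (t - 1)" using cayley_times[OF yD] by simp
  then have "cmod y * (t + 1) = \<bar>t - 1\<bar>"
    using t0 by (metis norm_mult norm_of_real abs_of_pos add_pos_pos zero_less_one)
  moreover have "cmod y * (t + 1) < R * (t + 1)" using y(1) t0 by (intro mult_strict_right_mono) auto
  moreover have "R * (t + 1) = 1 - t" using Ra ta by (simp add: add.commute)
  ultimately show False by linarith
qed

theorem theorem5:
  "(\<forall>f\<in>class_SH_S. \<forall>z b1 r \<rho>.
      b1 = dzbar f 0 \<and> \<rho> = 3 - 2 * sqrt 2 \<and> r = cmod z \<and> 0 < r \<and> r < 1 \<longrightarrow>
      curvature f z \<le> (1 + cmod b1) / (1 - cmod b1)\<^sup>2 * ((1 + r) / (1 - r)) ^ 4 * ((r\<^sup>2 + 6 * r + 1) / r) \<and>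
      (r \<le> \<rho> \<longrightarrow>
        curvature f z \<ge> (1 - cmod b1) / (1 + cmod b1)\<^sup>2 * ((1 - r) / (1 + r)) ^ 4 * ((r\<^sup>2 - 6 * r + 1) / r)) \<and>
      (\<rho> < r \<longrightarrow>
        curvature f z \<ge> (1 + cmod b1) / (1 - cmod b1)\<^sup>2 * ((1 + r) / (1 - r)) ^ 4 * ((r\<^sup>2 - 6 * r + 1) / r))) \<and>
   (\<forall>f\<in>class_SH_S. convex_domain (f ` ball 0 (3 - 2 * sqrt 2))) \<and>
   is_radius_of_convexity class_SH_S (3 - 2 * sqrt 2)"
proof (intro conjI ballI allI impI)
  have s: "1 < sqrt 2" "sqrt 2 < 3 / 2"
    by (simp, rule real_less_lsqrt) (auto simp: power2_eq_square)
  fix f z and b1 :: complex and r \<rho> :: real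
  assume f: "f \<in> class_SH_S"
    and as: "b1 = dzbar f 0 \<and> \<rho> = 3 - 2 * sqrt 2 \<and> r = cmod z \<and> 0 < r \<and> r < 1"
  obtain h g l c f0 where sp: "shear_pair h g l" "cmod c < 1" "inj_on f0 \<D>"
    "\<forall>z\<in>\<D>. f0 z = h z + cnj (g z)" "\<forall>z\<in>\<D>. f z = f0 z + c * cnj (f0 z)" "dzbar f 0 = c"
    by (rule class_SH_S_shear_pair[OF f])
  have fz: "f z = (h z + cnj (g z)) + c * cnj (h z + cnj (g z))" if "z \<in> \<D>" for z
    using sp(4,5) that by simp
  have b: "b1 = c" and r: "cmod z = r" "0 < r" "r < 1" using as sp(6) by auto
  note bounds = curvature_shear_pair_bounds[OF sp(1,2) fz r]
  show "curvature f z \<le> (1 + cmod b1) / (1 - cmod b1)\<^sup>2 * ((1 + r) / (1 - r)) ^ 4 * ((r\<^sup>2 + 6 * r + 1) / r)"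
    unfolding b by (rule bounds(1))
  show "(1 - cmod b1) / (1 + cmod b1)\<^sup>2 * ((1 - r) / (1 + r)) ^ 4 * ((r\<^sup>2 - 6 * r + 1) / r) \<le> curvature f z"
    if "r \<le> \<rho>"
  proof -
    \<comment> \<open>The other root 3 + 2 sqrt 2 exceeds 1, so on the unit interval the sign
      depends on the first factor alone.\<close>
    have "0 \<le> 3 - 2 * sqrt 2 - r" "0 \<le> 3 + 2 * sqrt 2 - r" using that as s by linarith+
    then have "0 \<le> r\<^sup>2 - 6*r + 1" unfolding radius_polynomial_factor by (rule mult_nonneg_nonneg)
    then show ?thesis unfolding b by (intro bounds(2))
  qed
  show "(1 + cmod b1) / (1 - cmod b1)\<^sup>2 * ((1 + r) / (1 - r)) ^ 4 * ((r\<^sup>2 - 6 * r + 1) / r) \<le> curvature f z"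
    if "\<rho> < r"
  proof -
    have "3 - 2 * sqrt 2 - r \<le> 0" "0 \<le> 3 + 2 * sqrt 2 - r" using that as s by linarith+
    then have "r\<^sup>2 - 6*r + 1 \<le> 0" unfolding radius_polynomial_factor by (rule mult_nonpos_nonneg)
    then show ?thesis unfolding b by (intro bounds(3))
  qed
next
  show "convex_domain (f ` ball 0 (3 - 2 * sqrt 2))" if "f \<in> class_SH_S" for f
    using that by (rule class_SH_S_convex_image)
next
  have s: "1 < sqrt 2" "sqrt 2 < 3 / 2"
    by (simp, rule real_less_lsqrt) (auto simp: power2_eq_square)
  have "R \<le> 3 - 2 * sqrt 2" if "R \<in> {0<..1}" "maps_disk_onto_convex class_SH_S R" for R
    using that harmonic_koebe_in_class harmonic_koebe_not_convex[of R]
    by (force simp: maps_disk_onto_convex_def convex_domain_def)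
  then show "is_radius_of_convexity class_SH_S (3 - 2 * sqrt 2)"
    unfolding is_radius_of_convexity_def using s class_SH_S_convex_image
    by (auto simp: maps_disk_onto_convex_def)
qed

end
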